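(* Let $\mathcal{H}$ be a complex Hilbert space, let $T = U|T|$ be the polar decomposition of a bounded linear operator $T$ on $\mathcal{H}$, and let $p,r>0$ be real numbers. The following conditions are equivalent: (i) $T$ is self-adjoint; (ii) $T$ is absolute-$(p,r)$-paranormal and $U$ is self-adjoint.
   Context: For a bounded linear operator $T$ on a complex Hilbert space $\mathcal{H}$, $|T|=(T^*T)^{1/2}$ and $|T^*|=(TT^* )^{1/2}$; real positive powers of positive operators are defined by functional calculus. The polar decomposition of $T$ is the unique factorization $T=U|T|$ in which $U$ is a partial isometry (i.e. $U^*U$ is an orthogonal projection) with null space $\mathcal{N}(U)=\mathcal{N}(|T|)$. For $p,r>0$, $T$ is called absolute-$(p,r)$-paranormal if $\| |T|^p |T^*|^r x \|^r \geq \| |T^*|^r x \|^{p+r}$ for every unit vector $x\in\mathcal{H}$ (equivalently, $\| |T|^p |T^*|^r x \|^r\|x\|^p \geq \| |T^*|^r x \|^{p+r}$ for all $x\in\mathcal{H}$). *)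

theory Defs
  imports "HOL-Analysis.Analysis" "HOL-Computational_Algebra.Polynomial"
begin

text \<open>
  Complex Hilbert spaces. The inner product is linear in its first and conjugate linear in its
  second argument; the real vector space structure is the restriction of the complex one.
\<close>

class complex_inner = real_normed_vector +
  fixes scaleC :: "complex \<Rightarrow> 'a \<Rightarrow> 'a" (infixr "*\<^sub>C" 75)
    and cinner :: "'a \<Rightarrow> 'a \<Rightarrow> complex"
  assumes scaleC_add_right: "a *\<^sub>C (x + y) = a *\<^sub>C x + a *\<^sub>C y"
    and scaleC_add_left: "(a + b) *\<^sub>C x = a *\<^sub>C x + b *\<^sub>C x"
    and scaleC_scaleC: "a *\<^sub>C (b *\<^sub>C x) = (a * b) *\<^sub>C x"
    and scaleR_scaleC: "t *\<^sub>R x = complex_of_real t *\<^sub>C x"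
    and cinner_commute: "cinner x y = cnj (cinner y x)"
    and cinner_add_left: "cinner (x + y) z = cinner x z + cinner y z"
    and cinner_scaleC_left: "cinner (a *\<^sub>C x) y = a * cinner x y"
    and norm_eq_sqrt_cinner: "norm x = sqrt (Re (cinner x x))"

class chilbert_space = complex_inner + banach

definition bounded_clinear :: "('a::complex_inner \<Rightarrow> 'a) \<Rightarrow> bool" where
  "bounded_clinear T \<longleftrightarrow> bounded_linear T \<and> (\<forall>a x. T (a *\<^sub>C x) = a *\<^sub>C T x)"

definition cadjoint :: "('a::complex_inner \<Rightarrow> 'a) \<Rightarrow> 'a \<Rightarrow> 'a" where
  "cadjoint T = (THE S. \<forall>x y. cinner (T x) y = cinner x (S y))"

definition self_adjoint :: "('a::complex_inner \<Rightarrow> 'a) \<Rightarrow> bool" where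
  "self_adjoint T \<longleftrightarrow> cadjoint T = T"

definition op_invertible :: "('a::complex_inner \<Rightarrow> 'a) \<Rightarrow> bool" where
  "op_invertible T \<longleftrightarrow> (\<exists>S. bounded_clinear S \<and> S \<circ> T = id \<and> T \<circ> S = id)"

definition spectrum :: "('a::complex_inner \<Rightarrow> 'a) \<Rightarrow> complex set" where
  "spectrum A = {z. \<not> op_invertible (\<lambda>x. A x - z *\<^sub>C x)}"

definition op_poly :: "complex poly \<Rightarrow> ('a::complex_inner \<Rightarrow> 'a) \<Rightarrow> 'a \<Rightarrow> 'a" where
  "op_poly q A = (\<lambda>x. \<Sum>i\<le>degree q. coeff q i *\<^sub>C (A ^^ i) x)"

text \<open>
  Continuous functional calculus of a self-adjoint operator \<open>A\<close> for a function \<open>f\<close> that is continuous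
  on the spectrum of \<open>A\<close>: the operator norm limit of \<open>q\<^sub>n(A)\<close> for polynomials \<open>q\<^sub>n\<close> that converge to
  \<open>f\<close> uniformly on the spectrum. As the spectrum is a compact set of reals, such polynomials exist,
  and the limit does not depend on their choice.
\<close>

definition fun_calc :: "(complex \<Rightarrow> complex) \<Rightarrow> ('a::complex_inner \<Rightarrow> 'a) \<Rightarrow> 'a \<Rightarrow> 'a" where
  "fun_calc f A = (THE B. bounded_clinear B \<and>
     (\<exists>q. uniform_limit (spectrum A) (\<lambda>n. poly (q n)) f sequentially \<and>
          (\<lambda>n. onorm (\<lambda>x. op_poly (q n) A x - B x)) \<longlonglongrightarrow> 0))"

text \<open>
  The spectrum of a positive operator lies in the nonnegative reals, so that \<open>Re\<close> is the identity
  there. For \<open>s > 0\<close> the convention \<open>0 powr s = 0\<close> is the usual value.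
\<close>

definition op_powr :: "('a::complex_inner \<Rightarrow> 'a) \<Rightarrow> real \<Rightarrow> 'a \<Rightarrow> 'a" where
  "op_powr A s = fun_calc (\<lambda>z. complex_of_real (Re z powr s)) A"

definition op_abs :: "('a::complex_inner \<Rightarrow> 'a) \<Rightarrow> 'a \<Rightarrow> 'a" where
  "op_abs T = op_powr (cadjoint T \<circ> T) (1/2)"

definition orthogonal_projection :: "('a::complex_inner \<Rightarrow> 'a) \<Rightarrow> bool" where
  "orthogonal_projection P \<longleftrightarrow> bounded_clinear P \<and> P \<circ> P = P \<and> self_adjoint P"

definition partial_isometry :: "('a::complex_inner \<Rightarrow> 'a) \<Rightarrow> bool" where
  "partial_isometry U \<longleftrightarrow> bounded_clinear U \<and> orthogonal_projection (cadjoint U \<circ> U)"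

definition null_space :: "('a::complex_inner \<Rightarrow> 'a) \<Rightarrow> 'a set" where
  "null_space T = {x. T x = 0}"

definition polar_decomposition :: "('a::complex_inner \<Rightarrow> 'a) \<Rightarrow> ('a \<Rightarrow> 'a) \<Rightarrow> bool" where
  "polar_decomposition T U \<longleftrightarrow>
     T = U \<circ> op_abs T \<and> partial_isometry U \<and> null_space U = null_space (op_abs T)"

definition absolute_paranormal :: "real \<Rightarrow> real \<Rightarrow> ('a::complex_inner \<Rightarrow> 'a) \<Rightarrow> bool" where
  "absolute_paranormal p r T \<longleftrightarrow>
     (\<forall>x. norm x = 1 \<longrightarrow>
        norm (op_powr (op_abs T) p (op_powr (op_abs (cadjoint T)) r x)) powr r
          \<ge> norm (op_powr (op_abs (cadjoint T)) r x) powr (p + r))"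

end

theory Submission
  imports Defs "HOL-Computational_Algebra.Fundamental_Theorem_Algebra" "HOL-Real_Asymp.Real_Asymp"
begin

text \<open>
  Write \<open>A = |T|\<close>, so that \<open>T = U A\<close>.

  Suppose that \<open>T\<close> is self-adjoint. Then \<open>|T*| = A\<close>, and paranormality becomes
  \<open>\<parallel>A\<^sup>r x\<parallel>\<close> to the power \<open>p + r\<close> being at most \<open>\<parallel>A\<^sup>p A\<^sup>r x\<parallel>\<close> to the power \<open>r\<close> for unit vectors \<open>x\<close>, which is the
  logarithmic convexity of \<open>s \<mapsto> \<parallel>A\<^sup>s x\<parallel>\<close> (\<open>op_powr_log_convex\<close>). Moreover \<open>T\<close> commutes with its
  modulus; comparing kernels, so does \<open>U\<close>, and the identities \<open>U U* U = U\<close> and \<open>U A = A U*\<close> then leave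
  only \<open>U = U*\<close> (\<open>self_adjoint_imp_polar_factor_self_adjoint\<close>).

  Conversely, suppose that \<open>U\<close> is self-adjoint and \<open>T\<close> paranormal. As \<open>U\<^sup>2\<close> is the projection onto the
  closure of the range of \<open>A\<close>, conjugation by \<open>U\<close> respects powers and \<open>|T*|\<^sup>r = U A\<^sup>r U\<close>.
  Put \<open>m = p + r\<close> and \<open>C = A\<^sup>m\<close>. Two applications of logarithmic convexity turn the hypothesis into
  \<open>\<parallel>C y\<parallel>\<^sup>2 \<le> \<parallel>C U C y\<parallel> \<parallel>y\<parallel>\<close>, whose exponents are gone. The decisive observation is that
  \<open>U C\<close> is, up to a similarity by the square root \<open>D\<close> of \<open>C\<close>, the self-adjoint operator
  \<open>J = D U D\<close>: one has \<open>D (U C) = J D\<close>. Rewritten in terms of \<open>J\<close>, the inequality says that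
  \<open>J\<^sup>2 C J\<^sup>2 - 2 \<mu> J C J + \<mu>\<^sup>2 C\<close> is a positive operator for every \<open>\<mu> \<ge> 0\<close>.
  If \<open>J w = \<sigma> w\<close> and \<open>\<mu> = \<sigma>\<^sup>2\<close>, then its quadratic form vanishes at \<open>w\<close>. A positive operator annihilates
  the vectors at which its form vanishes, and this reads \<open>\<sigma>\<^sup>2 (J - \<sigma>)\<^sup>2 C w = 0\<close>: so \<open>C\<close> maps eigenspaces
  of \<open>J\<close> to themselves. For continuous spectrum the eigenvectors are replaced by vectors
  in a spectral slice of width \<open>\<delta>\<close>; the error on each of the \<open>N \<approx> 1 / \<delta>\<close> slices is a multiple of \<open>\<delta>\<close>,
  and since the slices are nearly orthogonal, the errors add up to a multiple of \<open>\<delta> \<surd>N\<close> only, which tends to \<open>0\<close>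
  (\<open>zero_by_spectral_slices\<close>). Therefore \<open>J\<close> commutes with \<open>C\<close> (\<open>commute_if_moments_log_convex\<close>),
  hence \<open>U\<close> commutes with \<open>C\<close> (\<open>commute_if_paranormal_symmetry\<close>) and with its root \<open>A\<close>,
  and \<open>T* = A U = U A = T\<close>.

  Powers of positive operators are given by a definite description. That it describes something rests on
  the spectral theory of a self-adjoint operator \<open>A\<close>: its spectrum is real, and the norm of \<open>q(A)\<close> for a
  polynomial \<open>q\<close> is bounded by the supremum of \<open>|q|\<close> on the spectrum (\<open>op_poly_norm_le\<close>). With the
  Weierstrass theorem this gives existence, uniqueness and the algebraic rules of the functional calculus.
\<close>

section \<open>Complex inner products and bounded operators\<close>

lemma cinner_add_right: "cinner x (y + z) = cinner x y + cinner x (z::'a::complex_inner)"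
  by (simp add: cinner_commute[of x] cinner_add_left)

lemma cinner_scaleC_right: "cinner x (a *\<^sub>C y) = cnj a * cinner x (y::'a::complex_inner)"
  by (simp add: cinner_commute[of x] cinner_scaleC_left)

lemma scaleC_one: "1 *\<^sub>C (x::'a::complex_inner) = x"
  using scaleR_scaleC[of 1 x] by simp

lemma additive_scaleC_right: "Modules.additive (\<lambda>x::'a::complex_inner. a *\<^sub>C x)"
  by unfold_locales (rule scaleC_add_right)

lemma additive_scaleC_left: "Modules.additive (\<lambda>a. a *\<^sub>C (x::'a::complex_inner))"
  by unfold_locales (rule scaleC_add_left)

lemma additive_cinner_left: "Modules.additive (\<lambda>x. cinner x (y::'a::complex_inner))"
  by unfold_locales (rule cinner_add_left)

lemma additive_cinner_right: "Modules.additive (\<lambda>y. cinner x (y::'a::complex_inner))"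
  by unfold_locales (rule cinner_add_right)

lemmas scaleC_zero_right = Modules.additive.zero[OF additive_scaleC_right]
lemmas scaleC_diff_right = Modules.additive.diff[OF additive_scaleC_right]
lemmas scaleC_zero_left = Modules.additive.zero[OF additive_scaleC_left]
lemmas scaleC_minus_left = Modules.additive.minus[OF additive_scaleC_left]
lemmas cinner_zero_left [simp] = Modules.additive.zero[OF additive_cinner_left]
lemmas cinner_minus_left = Modules.additive.minus[OF additive_cinner_left]
lemmas cinner_diff_left = Modules.additive.diff[OF additive_cinner_left]
lemmas cinner_zero_right [simp] = Modules.additive.zero[OF additive_cinner_right]
lemmas cinner_minus_right = Modules.additive.minus[OF additive_cinner_right]
lemmas cinner_diff_right = Modules.additive.diff[OF additive_cinner_right]

lemma cinner_scaleR_left: "cinner (t *\<^sub>R x) (y::'a::complex_inner) = of_real t * cinner x y"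
  by (simp add: scaleR_scaleC cinner_scaleC_left)

lemma cinner_scaleR_right: "cinner x (t *\<^sub>R y::'a::complex_inner) = of_real t * cinner x y"
  by (simp add: scaleR_scaleC cinner_scaleC_right)

lemmas cinner_simps = cinner_add_left cinner_add_right cinner_diff_left cinner_diff_right
  cinner_minus_left cinner_minus_right cinner_scaleC_left cinner_scaleC_right
  cinner_scaleR_left cinner_scaleR_right

lemma Re_cinner_commute: "Re (cinner x y) = Re (cinner y (x::'a::complex_inner))"
  by (subst cinner_commute) simp

lemma cinner_self_eq: "cinner x x = of_real ((norm (x::'a::complex_inner))\<^sup>2)"
proof -
  have "cnj (cinner x x) = cinner x x"
    by (rule cinner_commute [symmetric])
  then have im: "Im (cinner x x) = 0"
    by (simp add: complex_eq_iff)
  have "norm x \<ge> 0"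
    by simp
  then have "Re (cinner x x) \<ge> 0"
    by (simp add: norm_eq_sqrt_cinner)
  then have "(norm x)\<^sup>2 = Re (cinner x x)"
    by (simp add: norm_eq_sqrt_cinner)
  with im show ?thesis
    by (simp add: complex_eq_iff)
qed

lemma norm_sq_cinner: "(norm (x::'a::complex_inner))\<^sup>2 = Re (cinner x x)"
  by (simp add: cinner_self_eq)

lemma norm_add_sq:
  "(norm (x + y::'a::complex_inner))\<^sup>2 = (norm x)\<^sup>2 + 2 * Re (cinner x y) + (norm y)\<^sup>2"
  using Re_cinner_commute[of x y] by (simp add: norm_sq_cinner cinner_simps)

lemma norm_diff_sq:
  "(norm (x - y::'a::complex_inner))\<^sup>2 = (norm x)\<^sup>2 - 2 * Re (cinner x y) + (norm y)\<^sup>2"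
  using Re_cinner_commute[of x y] by (simp add: norm_sq_cinner cinner_simps)

lemma norm_scaleC: "norm (a *\<^sub>C (x::'a::complex_inner)) = cmod a * norm x"
proof -
  have "cinner (a *\<^sub>C x) (a *\<^sub>C x) = (a * cnj a) * cinner x x"
    by (simp add: cinner_simps)
  also have "\<dots> = of_real ((cmod a)\<^sup>2 * (norm x)\<^sup>2)"
    by (simp only: cinner_self_eq of_real_mult complex_norm_square)
  finally have "(norm (a *\<^sub>C x))\<^sup>2 = (cmod a)\<^sup>2 * (norm x)\<^sup>2"
    unfolding norm_sq_cinner[of "a *\<^sub>C x"] by (simp only: Re_complex_of_real)
  then have "(norm (a *\<^sub>C x))\<^sup>2 = (cmod a * norm x)\<^sup>2"
    by (simp add: power_mult_distrib)
  then show ?thesis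
    by (simp add: power2_eq_iff_nonneg)
qed

lemma cinner_eqI:
  assumes "\<And>z. cinner z x = cinner z (y::'a::complex_inner)"
  shows "x = y"
proof -
  have "cinner (x - y) (x - y) = 0"
    using assms[of "x - y"] by (simp add: cinner_diff_right)
  then show ?thesis
    by (simp add: cinner_self_eq)
qed

lemma Cauchy_Schwarz_Re: "Re (cinner x y) \<le> norm x * norm (y::'a::complex_inner)"
proof (cases "x = 0 \<or> y = 0")
  case False
  then have pos: "norm x > 0" "norm y > 0" by auto
  have "0 \<le> (norm (norm y *\<^sub>R x - norm x *\<^sub>R y))\<^sup>2" by simp
  also have "\<dots> = 2 * (norm x)\<^sup>2 * (norm y)\<^sup>2 - 2 * (norm x * norm y) * Re (cinner x y)"
    by (simp add: norm_diff_sq cinner_simps power_mult_distrib algebra_simps)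
  finally have "(norm x * norm y) * Re (cinner x y) \<le> (norm x * norm y) * (norm x * norm y)"
    by (simp add: power2_eq_square algebra_simps)
  then show ?thesis
    using pos by (metis mult_le_cancel_left_pos mult_pos_pos)
qed auto

lemma Cauchy_Schwarz_abs_Re: "\<bar>Re (cinner x y)\<bar> \<le> norm x * norm (y::'a::complex_inner)"
  using Cauchy_Schwarz_Re[of x y] Cauchy_Schwarz_Re[of "-x" y]
  by (simp add: cinner_minus_left)

lemma Cauchy_Schwarz: "cmod (cinner x y) \<le> norm x * norm (y::'a::complex_inner)"
proof (cases "cinner x y = 0")
  case False
  define a where "a = cnj (cinner x y) / of_real (cmod (cinner x y))"
  have a: "cmod a = 1"
    using False by (simp add: a_def norm_divide)
  have "cinner (a *\<^sub>C x) y = of_real (cmod (cinner x y))"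
    using False complex_norm_square[of "cinner x y"]
    by (simp add: a_def cinner_simps power2_eq_square divide_simps mult.commute)
  then show ?thesis
    using Cauchy_Schwarz_Re[of "a *\<^sub>C x" y] a by (simp add: norm_scaleC)
qed auto

lemma bounded_clinearD:
  assumes "bounded_clinear T"
  shows "T (x + y) = T x + T y" "T (x - y) = T x - T y" "T (a *\<^sub>C x) = a *\<^sub>C T x"
    "T (t *\<^sub>R x) = t *\<^sub>R T x" "T 0 = 0" "T (- x) = - T x"
proof -
  interpret bounded_linear T using assms by (simp add: bounded_clinear_def)
  show "T (x + y) = T x + T y" "T (x - y) = T x - T y" "T (t *\<^sub>R x) = t *\<^sub>R T x" "T 0 = 0" "T (- x) = - T x"
    by (simp_all add: add diff scaleR zero neg)
  show "T (a *\<^sub>C x) = a *\<^sub>C T x" using assms by (simp add: bounded_clinear_def)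
qed

lemma bounded_clinear_bound:
  assumes "bounded_clinear T"
  obtains K where "K > 0" "\<And>x. norm (T x) \<le> K * norm x"
  using assms bounded_linear.pos_bounded unfolding bounded_clinear_def
  by (metis mult.commute)

lemma bounded_clinearI:
  assumes "\<And>x y. T (x + y) = T x + T y" "\<And>a x. T (a *\<^sub>C x) = a *\<^sub>C T x"
    and "\<And>x. norm (T x) \<le> K * norm x"
  shows "bounded_clinear T"
  unfolding bounded_clinear_def
proof
  show "bounded_linear T"
    by (rule bounded_linear_intro[where K = K])
      (auto simp: assms scaleR_scaleC mult.commute)
qed (use assms in auto)

lemma bounded_clinear_ident: "bounded_clinear (\<lambda>x. x)"
  by (rule bounded_clinearI[where K = 1]) auto

lemma bounded_clinear_zero: "bounded_clinear (\<lambda>x. 0)"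
  by (rule bounded_clinearI[where K = 1]) (auto simp: scaleC_zero_right)

lemma bounded_clinear_compose:
  assumes "bounded_clinear S" "bounded_clinear T"
  shows "bounded_clinear (\<lambda>x. S (T x))"
  using assms bounded_linear_compose[of S T] by (auto simp: bounded_clinear_def)

lemma bounded_clinear_add:
  assumes "bounded_clinear S" "bounded_clinear T"
  shows "bounded_clinear (\<lambda>x. S x + T x)"
  using assms bounded_linear_add[of S T] by (auto simp: bounded_clinear_def scaleC_add_right)

lemma bounded_clinear_diff:
  assumes "bounded_clinear S" "bounded_clinear T"
  shows "bounded_clinear (\<lambda>x. S x - T x)"
  using assms bounded_linear_sub[of S T] by (auto simp: bounded_clinear_def scaleC_diff_right)

lemma bounded_clinear_scaleC:
  assumes "bounded_clinear T"
  shows "bounded_clinear (\<lambda>x. a *\<^sub>C T x)"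
proof -
  obtain K where K: "K > 0" "\<And>x. norm (T x) \<le> K * norm x"
    using bounded_clinear_bound[OF assms] by auto
  have "norm (a *\<^sub>C T x) \<le> (cmod a * K) * norm x" for x
    using mult_left_mono[OF K(2)[of x], of "cmod a"] by (simp add: norm_scaleC mult.assoc)
  then show ?thesis
    by (intro bounded_clinearI[where K = "cmod a * K"])
      (simp_all add: bounded_clinearD[OF assms] scaleC_add_right scaleC_scaleC mult.commute)
qed

lemma bounded_clinear_scaleR:
  assumes "bounded_clinear T"
  shows "bounded_clinear (\<lambda>x. t *\<^sub>R T x)"
  using bounded_clinear_scaleC[OF assms] by (simp add: scaleR_scaleC)

lemmas bounded_clinear_intros = bounded_clinear_ident bounded_clinear_zero
  bounded_clinear_add bounded_clinear_diff bounded_clinear_scaleC bounded_clinear_scaleR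

section \<open>Adjoints\<close>

text \<open>
  This is the Riesz representation theorem for the functional \<open>x \<mapsto> \<langle>T x, y\<rangle>\<close>. The representing vector is the
  minimiser of the energy \<open>\<parallel>x\<parallel>\<^sup>2 - 2 Re \<langle>T x, y\<rangle>\<close>: minimising sequences are Cauchy by the
  parallelogram law, and stationarity of the energy at the minimiser is the asserted identity.
\<close>

lemma adjoint_vector_exists:
  fixes T :: "'a::chilbert_space \<Rightarrow> 'a"
  assumes T: "bounded_clinear T"
  shows "\<exists>z. \<forall>x. cinner (T x) y = cinner x z"
proof -
  note Tl = bounded_clinearD[OF T]
  obtain K where K: "K > 0" "\<And>x. norm (T x) \<le> K * norm x"
    using bounded_clinear_bound[OF T] by auto
  define E where "E x = (norm x)\<^sup>2 - 2 * Re (cinner (T x) y)" for x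
  have lower: "E x \<ge> - (K * norm y)\<^sup>2" for x
  proof -
    have "Re (cinner (T x) y) \<le> norm (T x) * norm y"
      by (rule Cauchy_Schwarz_Re)
    also have "\<dots> \<le> K * norm x * norm y"
      by (intro mult_right_mono K) auto
    finally have "E x \<ge> (norm x)\<^sup>2 - 2 * (K * norm y) * norm x"
      by (simp add: E_def algebra_simps)
    moreover have "(norm x - K * norm y)\<^sup>2 \<ge> 0" by simp
    ultimately show ?thesis
      by (simp add: power2_diff algebra_simps)
  qed
  define d where "d = (INF x. E x)"
  have bdd: "bdd_below (range E)"
    using lower by (intro bdd_belowI[where m = "- (K * norm y)\<^sup>2"]) auto
  have d_le: "d \<le> E x" for x
    unfolding d_def by (rule cINF_lower[OF bdd]) auto
  have "\<exists>x. E x < d + 1 / real (Suc n)" for n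
    using cINF_less_iff[OF _ bdd, of "d + 1 / real (Suc n)"] d_def by auto
  then obtain X where X: "\<And>n. E (X n) < d + 1 / real (Suc n)"
    by metis
  have par: "(norm (u - v))\<^sup>2 \<le> 2 * (E u - d) + 2 * (E v - d)" for u v
  proof -
    have "4 * E ((1/2) *\<^sub>R (u + v)) = (norm (u + v))\<^sup>2 - 4 * Re (cinner (T u) y) - 4 * Re (cinner (T v) y)"
      unfolding E_def Tl(4) norm_scaleR cinner_scaleR_left
      by (simp add: Tl(1) cinner_add_left power_mult_distrib power_divide add_divide_distrib)
    moreover have "(norm (u + v))\<^sup>2 + (norm (u - v))\<^sup>2 = 2 * (norm u)\<^sup>2 + 2 * (norm v)\<^sup>2"
      by (simp add: norm_add_sq norm_diff_sq)
    ultimately have "(norm (u - v))\<^sup>2 = 2 * E u + 2 * E v - 4 * E ((1/2) *\<^sub>R (u + v))"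
      by (simp add: E_def)
    then show ?thesis
      using d_le[of "(1/2) *\<^sub>R (u + v)"] by simp
  qed
  have "Cauchy X"
  proof (rule CauchyI)
    fix e :: real assume "e > 0"
    then obtain N where N: "real (Suc N) > 4 / e\<^sup>2"
      by (metis reals_Archimedean2 less_trans of_nat_less_iff lessI)
    have "norm (X m - X n) < e" if mn: "m \<ge> N" "n \<ge> N" for m n
    proof -
      have EX: "E (X k) - d < 1 / real (Suc N)" if "k \<ge> N" for k
      proof -
        have "E (X k) - d < 1 / real (Suc k)" using X[of k] by simp
        also have "\<dots> \<le> 1 / real (Suc N)" using that by (simp add: frac_le)
        finally show ?thesis .
      qed
      have "(norm (X m - X n))\<^sup>2 < 4 * (1 / real (Suc N))"
        using par[of "X m" "X n"] EX[OF mn(1)] EX[OF mn(2)] by argo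
      also have "\<dots> < e\<^sup>2"
        using N \<open>e > 0\<close> by (simp add: field_simps)
      finally show ?thesis
        using \<open>e > 0\<close> by (simp add: power2_less_imp_less)
    qed
    then show "\<exists>M. \<forall>m\<ge>M. \<forall>n\<ge>M. norm (X m - X n) < e" by blast
  qed
  then obtain z where z: "X \<longlonglongrightarrow> z"
    using convergent_eq_Cauchy by blast
  have bl: "bounded_linear T" using T by (simp add: bounded_clinear_def)
  have "(\<lambda>n. T (X n)) \<longlonglongrightarrow> T z"
    by (rule bounded_linear.tendsto[OF bl z])
  then have "(\<lambda>n. T (X n) - T z) \<longlonglongrightarrow> 0"
    by (simp add: LIM_zero_iff)
  then have "(\<lambda>n. norm (T (X n) - T z) * norm y) \<longlonglongrightarrow> 0"
    by (metis tendsto_mult_left_zero tendsto_norm_zero)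
  then have "(\<lambda>n. Re (cinner (T (X n) - T z) y)) \<longlonglongrightarrow> 0"
    by (rule Lim_null_comparison[rotated]) (auto simp: Cauchy_Schwarz_abs_Re)
  then have "(\<lambda>n. Re (cinner (T (X n)) y)) \<longlonglongrightarrow> Re (cinner (T z) y)"
    by (simp add: cinner_diff_left LIM_zero_iff)
  then have "(\<lambda>n. E (X n)) \<longlonglongrightarrow> E z"
    unfolding E_def by (intro tendsto_diff tendsto_mult tendsto_const tendsto_power tendsto_norm z)
  moreover have "(\<lambda>n. E (X n)) \<longlonglongrightarrow> d"
  proof (rule tendsto_sandwich[of "\<lambda>_. d" _ _ "\<lambda>n. d + 1 / real (Suc n)"])
    show "(\<lambda>n. d + 1 / real (Suc n)) \<longlonglongrightarrow> d"
      using tendsto_add[OF tendsto_const LIMSEQ_inverse_real_of_nat, of d]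
      by (simp add: inverse_eq_divide)
    show "\<forall>\<^sub>F n in sequentially. E (X n) \<le> d + 1 / real (Suc n)"
      using X by (intro always_eventually allI less_imp_le)
  qed (use d_le in auto)
  ultimately have Ez: "E z = d"
    using LIMSEQ_unique by blast
  have re: "Re (cinner (T h) y) = Re (cinner h z)" for h
  proof (rule ccontr)
    assume neq: "Re (cinner (T h) y) \<noteq> Re (cinner h z)"
    define c where "c = Re (cinner z h) - Re (cinner (T h) y)"
    \<comment> \<open>If the derivative \<open>2 c\<close> of the energy in direction \<open>h\<close> were nonzero, a short step would decrease it.\<close>
    have c0: "c \<noteq> 0" using neq Re_cinner_commute[of z h] by (simp add: c_def)
    have q: "0 \<le> 2 * t * c + t\<^sup>2 * (norm h)\<^sup>2" for t
      using d_le[of "z + t *\<^sub>R h"] unfolding Ez[symmetric]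
      by (simp add: E_def c_def norm_add_sq Tl cinner_simps power_mult_distrib algebra_simps)
    have h0: "(norm h)\<^sup>2 > 0"
      using neq Tl(5) by (cases "h = 0") (auto simp: Tl)
    have "2 * (- c / (norm h)\<^sup>2) * c + (- c / (norm h)\<^sup>2)\<^sup>2 * (norm h)\<^sup>2 = - (c\<^sup>2 / (norm h)\<^sup>2)"
      using h0 by (simp add: power2_eq_square)
    moreover have "c\<^sup>2 / (norm h)\<^sup>2 > 0"
      using h0 c0 by simp
    ultimately show False
      using q[of "- c / (norm h)\<^sup>2"] by linarith
  qed
  have "cinner (T x) y = cinner x z" for x
  proof (rule complex_eqI)
    show "Re (cinner (T x) y) = Re (cinner x z)" by (rule re)
    show "Im (cinner (T x) y) = Im (cinner x z)"
      using re[of "\<i> *\<^sub>C x"] by (simp add: Tl cinner_simps)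
  qed
  then show ?thesis by blast
qed

lemma cadjoint_eqI:
  assumes "\<And>x y. cinner (T x) y = cinner x (S y)"
  shows "cadjoint T = S"
  unfolding cadjoint_def
proof (rule the_equality)
  fix S' assume "\<forall>x y. cinner (T x) y = cinner x (S' y)"
  then show "S' = S"
    using assms by (intro ext cinner_eqI) metis
qed (use assms in auto)

lemma cinner_cadjoint:
  fixes T :: "'a::chilbert_space \<Rightarrow> 'a"
  assumes "bounded_clinear T"
  shows "cinner (T x) y = cinner x (cadjoint T y)"
proof -
  obtain S where S: "\<And>x y. cinner (T x) y = cinner x (S y)"
    using adjoint_vector_exists[OF assms] by metis
  then show ?thesis using cadjoint_eqI[of T S] by simp
qed

lemma cinner_cadjoint':
  fixes T :: "'a::chilbert_space \<Rightarrow> 'a"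
  assumes "bounded_clinear T"
  shows "cinner (cadjoint T x) y = cinner x (T y)"
  by (metis assms cinner_cadjoint cinner_commute)

lemma bounded_clinear_cadjoint:
  fixes T :: "'a::chilbert_space \<Rightarrow> 'a"
  assumes "bounded_clinear T"
  shows "bounded_clinear (cadjoint T)"
proof -
  obtain K where K: "K > 0" "\<And>x. norm (T x) \<le> K * norm x"
    using bounded_clinear_bound[OF assms] by auto
  note adj = cinner_cadjoint[OF assms, symmetric]
  show ?thesis
  proof (rule bounded_clinearI[where K = K])
    show "cadjoint T (x + y) = cadjoint T x + cadjoint T y" for x y
      by (rule cinner_eqI) (simp add: adj cinner_simps)
    show "cadjoint T (a *\<^sub>C x) = a *\<^sub>C cadjoint T x" for a x
      by (rule cinner_eqI) (simp add: adj cinner_simps)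
    show "norm (cadjoint T x) \<le> K * norm x" for x
    proof (cases "cadjoint T x = 0")
      case False
      have "(norm (cadjoint T x))\<^sup>2 = Re (cinner (T (cadjoint T x)) x)"
        by (simp add: norm_sq_cinner adj)
      also have "\<dots> \<le> norm (T (cadjoint T x)) * norm x"
        by (rule Cauchy_Schwarz_Re)
      also have "\<dots> \<le> (K * norm (cadjoint T x)) * norm x"
        by (intro mult_right_mono K) auto
      finally have "norm (cadjoint T x) * norm (cadjoint T x) \<le> norm (cadjoint T x) * (K * norm x)"
        by (simp add: power2_eq_square algebra_simps)
      then show ?thesis using False by simp
    qed (use K in auto)
  qed
qed

text \<open>
  Unlike \<open>self_adjoint\<close>, which is an equation between an operator and a definite description, this includes
  boundedness and can be verified without knowing that an adjoint exists.
\<close>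

definition sym_op :: "('a::complex_inner \<Rightarrow> 'a) \<Rightarrow> bool" where
  "sym_op A \<longleftrightarrow> bounded_clinear A \<and> (\<forall>x y. cinner (A x) y = cinner x (A y))"

lemma sym_opD:
  assumes "sym_op A"
  shows "bounded_clinear A" "cinner (A x) y = cinner x (A y)"
  using assms by (auto simp: sym_op_def)

lemma sym_op_cadjoint: "sym_op A \<Longrightarrow> cadjoint A = A"
  by (rule cadjoint_eqI) (auto simp: sym_op_def)

lemma self_adjoint_iff_sym_op:
  fixes T :: "'a::chilbert_space \<Rightarrow> 'a"
  assumes "bounded_clinear T"
  shows "self_adjoint T \<longleftrightarrow> sym_op T"
  using assms cinner_cadjoint[OF assms] sym_op_cadjoint[of T]
  by (auto simp: self_adjoint_def sym_op_def)

definition pos_op :: "('a::complex_inner \<Rightarrow> 'a) \<Rightarrow> bool" where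
  "pos_op A \<longleftrightarrow> sym_op A \<and> (\<forall>x. 0 \<le> Re (cinner (A x) x))"

text \<open>
  The quantitative form of the fact that a positive operator annihilates every vector at which its quadratic form
  vanishes; it follows from positivity of the form at \<open>x - G x / g\<close>.
\<close>

lemma pos_op_norm_sq_le:
  assumes G: "pos_op G" and g: "g > 0" "\<And>x. norm (G x) \<le> g * norm x"
  shows "(norm (G x))\<^sup>2 \<le> g * Re (cinner (G x) x)"
proof -
  have bc: "bounded_clinear G" and sy: "\<And>x y. cinner (G x) y = cinner x (G y)"
    and nn: "\<And>x. 0 \<le> Re (cinner (G x) x)"
    using G by (auto simp: pos_op_def sym_op_def)
  define t where "t = 1 / g"
  have "Re (cinner (G (G x)) (G x)) \<le> norm (G (G x)) * norm (G x)"
    by (rule Cauchy_Schwarz_Re)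
  also have "\<dots> \<le> g * norm (G x) * norm (G x)"
    by (intro mult_right_mono g) auto
  finally have b: "Re (cinner (G (G x)) (G x)) \<le> g * (norm (G x))\<^sup>2"
    by (simp add: power2_eq_square)
  have "0 \<le> Re (cinner (G (x - t *\<^sub>R G x)) (x - t *\<^sub>R G x))" by (rule nn)
  also have "\<dots> = Re (cinner (G x) x) - 2 * t * (norm (G x))\<^sup>2 + t\<^sup>2 * Re (cinner (G (G x)) (G x))"
    by (simp add: bounded_clinearD[OF bc] cinner_simps sy[of "G x" x] norm_sq_cinner [symmetric]
        power2_eq_square algebra_simps)
  also have "\<dots> \<le> Re (cinner (G x) x) - 2 * t * (norm (G x))\<^sup>2 + t\<^sup>2 * (g * (norm (G x))\<^sup>2)"
    using b by (intro add_left_mono mult_left_mono) auto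
  also have "\<dots> = Re (cinner (G x) x) - (norm (G x))\<^sup>2 / g"
    using g by (simp add: t_def power2_eq_square field_simps)
  finally show ?thesis using g by (simp add: field_simps)
qed

section \<open>Polynomials of an operator\<close>

lemma op_poly_0 [simp]: "op_poly 0 A = (\<lambda>x. 0)"
  by (simp add: op_poly_def scaleC_zero_left)

lemma op_poly_pCons:
  assumes A: "bounded_clinear A"
  shows "op_poly (pCons c q) A = (\<lambda>x. c *\<^sub>C x + A (op_poly q A x))"
proof (cases "q = 0")
  case True
  then show ?thesis
    by (cases "c = 0") (auto simp: op_poly_def bounded_clinearD[OF A] scaleC_zero_left)
next
  case False
  interpret bounded_linear A using A by (simp add: bounded_clinear_def)
  have "op_poly (pCons c q) A x = c *\<^sub>C x + (\<Sum>i\<le>degree q. coeff q i *\<^sub>C A ((A ^^ i) x))" for x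
    using False by (simp add: op_poly_def degree_pCons_eq sum.atMost_Suc_shift del: sum.atMost_Suc)
  then show ?thesis
    by (auto simp: op_poly_def sum bounded_clinearD(3)[OF A])
qed

lemma bounded_clinear_op_poly:
  assumes A: "bounded_clinear A"
  shows "bounded_clinear (op_poly q A)"
  by (induction q)
    (auto simp: op_poly_pCons[OF A] intro!: bounded_clinear_intros bounded_clinear_compose[OF A])

lemma op_poly_add:
  assumes A: "bounded_clinear A"
  shows "op_poly (p + q) A x = op_poly p A x + op_poly q A x"
  by (induction p q rule: poly_induct2)
    (simp_all add: op_poly_pCons[OF A] bounded_clinearD[OF A] scaleC_add_left algebra_simps)

lemma op_poly_smult:
  assumes A: "bounded_clinear A"
  shows "op_poly (smult c q) A x = c *\<^sub>C op_poly q A x"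
  by (induction q)
    (simp_all add: op_poly_pCons[OF A] bounded_clinearD[OF A] scaleC_add_right scaleC_scaleC
      scaleC_zero_right)

lemma op_poly_diff:
  assumes A: "bounded_clinear A"
  shows "op_poly (p - q) A x = op_poly p A x - op_poly q A x"
  using op_poly_add[OF A, of "p - q" q x] by (simp add: algebra_simps)

lemma op_poly_mult:
  assumes A: "bounded_clinear A"
  shows "op_poly (p * q) A x = op_poly p A (op_poly q A x)"
  by (induction p)
    (simp_all add: op_poly_pCons[OF A] op_poly_add[OF A] op_poly_smult[OF A] scaleC_zero_left)

lemma op_poly_const:
  assumes A: "bounded_clinear A"
  shows "op_poly [:c:] A x = c *\<^sub>C x"
  by (simp add: op_poly_pCons[OF A] bounded_clinearD[OF A])

lemma op_poly_linear:
  assumes A: "bounded_clinear A"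
  shows "op_poly [:c, d:] A x = c *\<^sub>C x + d *\<^sub>C A x"
  by (simp add: op_poly_pCons[OF A] bounded_clinearD[OF A])

lemma op_poly_commute:
  assumes A: "bounded_clinear A" and D: "bounded_clinear D" and c: "\<And>x. D (A x) = A (D x)"
  shows "D (op_poly q A x) = op_poly q A (D x)"
  by (induction q arbitrary: x)
    (simp_all add: op_poly_pCons[OF A] bounded_clinearD[OF D] c)

lemma cinner_op_poly:
  assumes A: "sym_op A"
  shows "cinner (op_poly q A x) y = cinner x (op_poly (map_poly cnj q) A y)"
proof (induction q arbitrary: x y)
  case 0
  then show ?case by simp
next
  case (pCons a q)
  note bA = sym_opD(1)[OF A]
  have "op_poly q A (A y) = A (op_poly q A y)" for q y
    using op_poly_commute[OF bA bA, of q y] by simp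
  then show ?case
    using pCons.IH by (simp add: map_poly_pCons op_poly_pCons[OF bA] cinner_simps sym_opD(2)[OF A])
qed

section \<open>Invertibility and the spectrum\<close>

text \<open>
  A normal operator that is bounded below is invertible. The operator \<open>Q = N* N\<close> satisfies
  \<open>c\<^sup>2 \<le> Q\<close>, so that \<open>1 - e Q\<close> is a strict contraction for small \<open>e > 0\<close>, and Banach's fixed point
  theorem solves \<open>Q x = y\<close>; normality moves the preimage from \<open>Q\<close> to \<open>N\<close>.
\<close>

lemma op_invertibleI:
  fixes N :: "'a::chilbert_space \<Rightarrow> 'a"
  assumes N: "bounded_clinear N" and N': "bounded_clinear N'"
    and adj: "\<And>x y. cinner (N x) y = cinner x (N' y)"
    and comm: "\<And>x. N (N' x) = N' (N x)"
    and c: "c > 0" "\<And>x. c * norm x \<le> norm (N x)"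
  shows "op_invertible N"
proof -
  define Q where "Q x = N' (N x)" for x
  have Q: "bounded_clinear Q"
    unfolding Q_def by (rule bounded_clinear_compose[OF N' N])
  note Ql = bounded_clinearD[OF Q]
  obtain K where K: "K > 0" "\<And>x. norm (Q x) \<le> K * norm x"
    using bounded_clinear_bound[OF Q] by auto
  have Qc: "Re (cinner x (Q x)) \<ge> c\<^sup>2 * (norm x)\<^sup>2" for x
  proof -
    have "(c * norm x)\<^sup>2 \<le> (norm (N x))\<^sup>2"
      using c by (intro power_mono) auto
    then show ?thesis by (simp add: Q_def adj[symmetric] norm_sq_cinner[symmetric] power_mult_distrib)
  qed
  \<comment> \<open>Chosen so that \<open>e K\<^sup>2 \<le> c\<^sup>2\<close>, which controls the quadratic term below, and \<open>e c\<^sup>2 \<le> 1\<close>.\<close>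
  define e where "e = c\<^sup>2 / (K\<^sup>2 + c\<^sup>2 * c\<^sup>2)"
  have den: "K\<^sup>2 + c\<^sup>2 * c\<^sup>2 > 0" using K(1) by (simp add: add_pos_nonneg)
  have e: "e > 0" using den c(1) by (simp add: e_def)
  have eK: "e * (K\<^sup>2 + c\<^sup>2 * c\<^sup>2) = c\<^sup>2" using den by (simp add: e_def)
  define q where "q = sqrt (1 - e * c\<^sup>2)"
  have "e * c\<^sup>2 * (c\<^sup>2) \<le> e * (K\<^sup>2 + c\<^sup>2 * c\<^sup>2)"
    using e by (simp add: mult_left_mono mult.assoc)
  then have "(e * c\<^sup>2) * c\<^sup>2 \<le> 1 * c\<^sup>2" using eK by simp
  then have ec1: "e * c\<^sup>2 \<le> 1" using c(1) by (metis mult_right_le_imp_le zero_less_power)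
  have q: "0 \<le> q" "q < 1" using ec1 e c(1) by (auto simp: q_def real_sqrt_lt_1_iff)
  have contr: "norm (x - e *\<^sub>R Q x) \<le> q * norm x" for x
  proof -
    have "(norm (x - e *\<^sub>R Q x))\<^sup>2 = (norm x)\<^sup>2 - 2 * e * Re (cinner x (Q x)) + e\<^sup>2 * (norm (Q x))\<^sup>2"
      using e by (simp add: norm_diff_sq cinner_simps power_mult_distrib)
    also have "\<dots> \<le> (norm x)\<^sup>2 - 2 * e * (c\<^sup>2 * (norm x)\<^sup>2) + e\<^sup>2 * (K * norm x)\<^sup>2"
      using e K(2)[of x] by (intro add_mono diff_mono mult_left_mono power_mono Qc) auto
    also have "\<dots> = (1 - e * c\<^sup>2 - e * (c\<^sup>2 - e * K\<^sup>2)) * (norm x)\<^sup>2"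
      by (simp add: algebra_simps power2_eq_square)
    also have "\<dots> \<le> (1 - e * c\<^sup>2) * (norm x)\<^sup>2"
    proof (rule mult_right_mono)
      have "c\<^sup>2 - e * K\<^sup>2 = e * (c\<^sup>2 * c\<^sup>2)"
        using eK by (simp add: algebra_simps)
      then have "c\<^sup>2 - e * K\<^sup>2 \<ge> 0" using e by simp
      then show "1 - e * c\<^sup>2 - e * (c\<^sup>2 - e * K\<^sup>2) \<le> 1 - e * c\<^sup>2" using e by simp
    qed auto
    also have "\<dots> = (q * norm x)\<^sup>2"
      using ec1 by (simp add: q_def power_mult_distrib)
    finally show ?thesis
      by (rule power2_le_imp_le) (use q(1) in auto)
  qed
  have surjQ: "\<exists>x. Q x = y" for y
  proof -
    have "\<exists>!x. x - e *\<^sub>R (Q x - y) = x"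
    proof (rule banach_fix_type[of q])
      show "\<forall>x z. dist (x - e *\<^sub>R (Q x - y)) (z - e *\<^sub>R (Q z - y)) \<le> q * dist x z"
      proof (intro allI)
        fix x z
        have "x - e *\<^sub>R (Q x - y) - (z - e *\<^sub>R (Q z - y)) = (x - z) - e *\<^sub>R Q (x - z)"
          by (simp add: Ql algebra_simps)
        then show "dist (x - e *\<^sub>R (Q x - y)) (z - e *\<^sub>R (Q z - y)) \<le> q * dist x z"
          using contr[of "x - z"] by (simp only: dist_norm)
      qed
    qed (use q in auto)
    then obtain x where "x - e *\<^sub>R (Q x - y) = x" by blast
    then have "e *\<^sub>R (Q x - y) = 0" by (simp only: diff_eq_eq) simp
    then have "Q x - y = 0" using e by (simp del: right_minus_eq)
    then show ?thesis by (intro exI[of _ x]) simp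
  qed
  have "\<exists>x. N x = y" for y
    using surjQ[of y] comm by (metis Q_def)
  then obtain S where S: "\<And>y. N (S y) = y" by metis
  have inj: "x = y" if "N x = N y" for x y
    using c(2)[of "x - y"] c(1) that
    by (simp add: bounded_clinearD[OF N] mult_le_0_iff)
  have "bounded_clinear S"
  proof (rule bounded_clinearI[where K = "1 / c"])
    show "S (x + y) = S x + S y" for x y
      by (rule inj) (simp add: bounded_clinearD[OF N] S)
    show "S (a *\<^sub>C x) = a *\<^sub>C S x" for a x
      by (rule inj) (simp add: bounded_clinearD[OF N] S)
    show "norm (S x) \<le> 1 / c * norm x" for x
      using c(2)[of "S x"] c(1) by (simp add: S field_simps)
  qed
  moreover have "S (N x) = x" for x by (rule inj) (simp add: S)
  ultimately show ?thesis
    unfolding op_invertible_def using S by (intro exI[of _ S]) auto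
qed

text \<open>
  Points of the spectrum of a self-adjoint operator are approximate eigenvalues.
  All localisation of the spectrum below is obtained by contradicting this.
\<close>

lemma spectrum_memberE:
  fixes A :: "'a::chilbert_space \<Rightarrow> 'a"
  assumes A: "sym_op A" and z: "z \<in> spectrum A" and c: "c > 0"
  obtains x where "norm (A x - z *\<^sub>C x) < c * norm x"
proof -
  note bA = sym_opD(1)[OF A]
  have "\<exists>x. norm (A x - z *\<^sub>C x) < c * norm x"
  proof (rule ccontr)
    assume "\<nexists>x. norm (A x - z *\<^sub>C x) < c * norm x"
    then have "op_invertible (\<lambda>x. A x - z *\<^sub>C x)"
      by (intro op_invertibleI[where N' = "\<lambda>x. A x - cnj z *\<^sub>C x" and c = c])
        (auto simp: cinner_simps sym_opD(2)[OF A] bounded_clinearD[OF bA] scaleC_diff_right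
          scaleC_scaleC not_less mult.commute algebra_simps c
          intro!: bounded_clinear_intros bA)
    then show False using z by (simp add: spectrum_def)
  qed
  then show ?thesis using that by blast
qed

lemma spectrum_sym_op_real:
  fixes A :: "'a::chilbert_space \<Rightarrow> 'a"
  assumes A: "sym_op A" and z: "z \<in> spectrum A"
  shows "Im z = 0"
proof (rule ccontr)
  assume im: "Im z \<noteq> 0"
  note bA = sym_opD(1)[OF A]
  obtain x where x: "norm (A x - z *\<^sub>C x) < \<bar>Im z\<bar> * norm x"
    using spectrum_memberE[OF A z, of "\<bar>Im z\<bar>"] im by auto
  then have x0: "norm x > 0"
    by (cases "x = 0") (auto simp: bounded_clinearD[OF bA] scaleC_zero_right)
  have "cnj (cinner (A x) x) = cinner (A x) x"
    using cinner_commute[of x "A x"] by (simp add: sym_opD(2)[OF A])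
  then have "Im (cinner (A x) x) = 0"
    by (simp add: complex_eq_iff)
  then have "\<bar>Im z\<bar> * norm x * norm x = \<bar>Im (cinner (A x - z *\<^sub>C x) x)\<bar>"
    by (simp add: cinner_simps cinner_self_eq abs_mult power2_eq_square)
  also have "\<dots> \<le> cmod (cinner (A x - z *\<^sub>C x) x)"
    by (rule abs_Im_le_cmod)
  also have "\<dots> \<le> norm (A x - z *\<^sub>C x) * norm x"
    by (rule Cauchy_Schwarz)
  also have "\<dots> < (\<bar>Im z\<bar> * norm x) * norm x"
    using x x0 by (intro mult_strict_right_mono) auto
  finally show False by simp
qed

lemma spectrum_norm_le:
  fixes A :: "'a::chilbert_space \<Rightarrow> 'a"
  assumes A: "sym_op A" and M: "\<And>x. norm (A x) \<le> M * norm x" and z: "z \<in> spectrum A"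
  shows "cmod z \<le> M"
proof (rule ccontr)
  assume "\<not> cmod z \<le> M"
  then obtain x where "norm (A x - z *\<^sub>C x) < (cmod z - M) * norm x"
    using spectrum_memberE[OF A z, of "cmod z - M"] by auto
  moreover have "norm (z *\<^sub>C x) \<le> norm (A x - z *\<^sub>C x) + norm (A x)"
    using norm_triangle_ineq4[of "A x" "A x - z *\<^sub>C x"] by simp
  ultimately show False
    using M[of x] by (simp add: norm_scaleC algebra_simps)
qed

lemma spectrum_pos_op:
  fixes A :: "'a::chilbert_space \<Rightarrow> 'a"
  assumes A: "pos_op A" and z: "z \<in> spectrum A"
  shows "0 \<le> Re z"
proof (rule ccontr)
  assume re: "\<not> 0 \<le> Re z"
  have s: "sym_op A" using A by (simp add: pos_op_def)
  obtain x where x: "norm (A x - z *\<^sub>C x) < (- Re z) * norm x"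
    using spectrum_memberE[OF s z, of "- Re z"] re by auto
  then have x0: "norm x > 0"
    using re by (cases "x = 0") (auto simp: sym_opD[OF s] bounded_clinearD[OF sym_opD(1)[OF s]] scaleC_zero_right)
  have "(- Re z) * (norm x)\<^sup>2 \<le> Re (cinner (A x - z *\<^sub>C x) x)"
    using A by (simp add: cinner_simps cinner_self_eq pos_op_def)
  also have "\<dots> \<le> norm (A x - z *\<^sub>C x) * norm x"
    by (rule Cauchy_Schwarz_Re)
  also have "\<dots> < ((- Re z) * norm x) * norm x"
    using x x0 by (intro mult_strict_right_mono) auto
  finally show False by (simp add: power2_eq_square)
qed

lemma op_invertible_compose:
  assumes "op_invertible S" "op_invertible T"
  shows "op_invertible (\<lambda>x. S (T x))"
proof -
  obtain S' T' where "bounded_clinear S'" "S' \<circ> S = id" "S \<circ> S' = id"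
     "bounded_clinear T'" "T' \<circ> T = id" "T \<circ> T' = id"
    using assms by (auto simp: op_invertible_def)
  then show ?thesis
    unfolding op_invertible_def
    by (intro exI[of _ "\<lambda>x. T' (S' x)"]) (auto simp: fun_eq_iff intro: bounded_clinear_compose)
qed

text \<open>
  One half of the spectral mapping theorem: \<open>g(A)\<close> is a product of factors \<open>A - z\<close> over the roots \<open>z\<close> of \<open>g\<close>,
  so one of the factors is not invertible.
\<close>

lemma poly_root_in_spectrum:
  fixes A :: "'a::chilbert_space \<Rightarrow> 'a"
  assumes A: "bounded_clinear A" and g: "g \<noteq> 0" "\<not> op_invertible (op_poly g A)"
  shows "\<exists>z\<in>spectrum A. poly g z = 0"
  using g
proof (induction "degree g" arbitrary: g)
  case 0
  then obtain c where c: "g = [:c:]" "c \<noteq> 0"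
    by (metis degree_eq_zeroE pCons_0_0)
  have "op_invertible (op_poly g A)"
    unfolding op_invertible_def
    by (rule exI[of _ "\<lambda>x. inverse c *\<^sub>C x"])
      (auto simp: c op_poly_const[OF A] fun_eq_iff scaleC_scaleC scaleC_one
        intro!: bounded_clinear_intros)
  then show ?case using 0 by simp
next
  case (Suc n)
  then obtain z where z: "poly g z = 0"
    using fundamental_theorem_of_algebra[of g] by (auto simp: constant_degree)
  then obtain h where h: "g = [:- z, 1:] * h"
    by (metis dvdE poly_eq_0_iff_dvd)
  then have h0: "h \<noteq> 0"
    using Suc.prems by auto
  have "degree g = Suc (degree h)"
    unfolding h using h0 by (subst degree_mult_eq) auto
  then have hn: "degree h = n"
    using Suc.hyps by simp
  show ?case
  proof (cases "z \<in> spectrum A")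
    case False
    then have i: "op_invertible (\<lambda>x. A x - z *\<^sub>C x)"
      by (simp add: spectrum_def)
    have "op_poly g A = (\<lambda>x. A (op_poly h A x) - z *\<^sub>C op_poly h A x)"
      by (simp add: h op_poly_mult[OF A] op_poly_linear[OF A] scaleC_minus_left scaleC_one
          fun_eq_iff del: mult_pCons_left)
    then have "\<not> op_invertible (op_poly h A)"
      using op_invertible_compose[OF i, of "op_poly h A"] Suc.prems by auto
    then obtain w where "w \<in> spectrum A" "poly h w = 0"
      using Suc.hyps(1)[of h] h0 hn by auto
    then show ?thesis using h by auto
  qed (use z in auto)
qed

text \<open>
  The number \<open>\<parallel>q(A)\<parallel>\<^sup>2\<close> is an approximate eigenvalue of \<open>q(A)* q(A)\<close>: vectors that almost attain the norm are almost
  eigenvectors. A bounded inverse would improve the bound \<open>L\<close> by a fixed amount.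
\<close>

lemma spectrum_attains_norm:
  fixes A :: "'a::chilbert_space \<Rightarrow> 'a"
  assumes A: "sym_op A" and L: "L > 0"
    and le: "\<And>x. norm (op_poly q A x) \<le> L * norm x"
    and least: "\<And>L'. (\<And>x. norm (op_poly q A x) \<le> L' * norm x) \<Longrightarrow> L \<le> L'"
  shows "\<not> op_invertible (op_poly (map_poly cnj q * q - [:of_real (L\<^sup>2):]) A)"
proof
  note bA = sym_opD(1)[OF A]
  let ?C = "op_poly q A" and ?C' = "op_poly (map_poly cnj q) A"
  have adj: "cinner (?C x) y = cinner x (?C' y)" for x y
    by (rule cinner_op_poly[OF A])
  have adj': "cinner (?C' x) y = cinner x (?C y)" for x y
    by (metis adj cinner_commute)
  have eq: "op_poly (map_poly cnj q * q - [:of_real (L\<^sup>2):]) A x = ?C' (?C x) - L\<^sup>2 *\<^sub>R x" for x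
    by (simp add: op_poly_diff[OF bA] op_poly_mult[OF bA] op_poly_const[OF bA] scaleR_scaleC)
  have le': "norm (?C' y) \<le> L * norm y" for y
  proof (cases "?C' y = 0")
    case False
    have "norm (?C' y) * norm (?C' y) = Re (cinner (?C (?C' y)) y)"
      by (simp add: adj norm_sq_cinner[symmetric] power2_eq_square)
    also have "\<dots> \<le> norm (?C (?C' y)) * norm y" by (rule Cauchy_Schwarz_Re)
    also have "\<dots> \<le> L * norm (?C' y) * norm y" by (intro mult_right_mono le) auto
    finally have "norm (?C' y) * norm (?C' y) \<le> norm (?C' y) * (L * norm y)"
      by (simp add: algebra_simps)
    then show ?thesis using False by simp
  qed (use L in auto)
  assume "op_invertible (op_poly (map_poly cnj q * q - [:of_real (L\<^sup>2):]) A)"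
  then obtain S where S: "bounded_clinear S" "\<And>x. S (?C' (?C x) - L\<^sup>2 *\<^sub>R x) = x"
    by (auto simp: op_invertible_def fun_eq_iff eq [symmetric])
  obtain s where s: "s > 0" "\<And>x. norm (S x) \<le> s * norm x"
    using bounded_clinear_bound[OF S(1)] by auto
  define d where "d = 1 / (s\<^sup>2 * L\<^sup>2)"
  have d: "d > 0" using s L by (simp add: d_def)
  have key: "(norm (?C x))\<^sup>2 \<le> (L\<^sup>2 - d) * (norm x)\<^sup>2" for x
  proof -
    have "norm x \<le> s * norm (?C' (?C x) - L\<^sup>2 *\<^sub>R x)"
      using s(2)[of "?C' (?C x) - L\<^sup>2 *\<^sub>R x"] S(2) by simp
    then have "(norm x)\<^sup>2 \<le> (s * norm (?C' (?C x) - L\<^sup>2 *\<^sub>R x))\<^sup>2"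
      by (intro power_mono) auto
    also have "\<dots> = s\<^sup>2 * ((norm (?C' (?C x)))\<^sup>2 - 2 * L\<^sup>2 * (norm (?C x))\<^sup>2 + (L\<^sup>2)\<^sup>2 * (norm x)\<^sup>2)"
      by (simp add: power_mult_distrib norm_diff_sq cinner_simps adj' norm_sq_cinner[symmetric])
    also have "\<dots> \<le> s\<^sup>2 * ((L * norm (?C x))\<^sup>2 - 2 * L\<^sup>2 * (norm (?C x))\<^sup>2 + (L\<^sup>2)\<^sup>2 * (norm x)\<^sup>2)"
      by (intro mult_left_mono add_mono diff_mono power_mono le') auto
    also have "\<dots> = s\<^sup>2 * L\<^sup>2 * (L\<^sup>2 * (norm x)\<^sup>2 - (norm (?C x))\<^sup>2)"
      by (simp add: algebra_simps power_mult_distrib power2_eq_square)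
    finally have "d * (norm x)\<^sup>2 \<le> L\<^sup>2 * (norm x)\<^sup>2 - (norm (?C x))\<^sup>2"
      using s L by (simp add: d_def field_simps)
    then show ?thesis by (simp add: algebra_simps)
  qed
  show False
  proof (cases "L\<^sup>2 - d \<ge> 0")
    case True
    have "norm (?C x) \<le> sqrt (L\<^sup>2 - d) * norm x" for x
      by (rule power2_le_imp_le) (use key[of x] True in \<open>simp_all add: power_mult_distrib\<close>)
    then have "L \<le> sqrt (L\<^sup>2 - d)" by (rule least)
    then have "L\<^sup>2 \<le> (sqrt (L\<^sup>2 - d))\<^sup>2" using L by (intro power_mono) auto
    then show False using d True by simp
  next
    case False
    have "norm (?C x) \<le> 0 * norm x" for x
    proof -
      have "(L\<^sup>2 - d) * (norm x)\<^sup>2 \<le> 0"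
        using False by (intro mult_nonpos_nonneg) auto
      with key[of x] have "(norm (?C x))\<^sup>2 \<le> 0" by linarith
      then show ?thesis by simp
    qed
    then have "L \<le> 0" by (rule least)
    then show False using L by simp
  qed
qed

lemma op_poly_least_bound:
  assumes A: "bounded_clinear A"
  shows "norm (op_poly q A x) \<le> onorm (op_poly q A) * norm x"
    "(\<And>x. norm (op_poly q A x) \<le> L' * norm x) \<Longrightarrow> 0 \<le> L' \<Longrightarrow> onorm (op_poly q A) \<le> L'"
  using bounded_clinear_op_poly[OF A, of q] onorm[of "op_poly q A" x] onorm_bound[of L' "op_poly q A"]
  by (auto simp: bounded_clinear_def)

section \<open>The norm of a polynomial of a self-adjoint operator\<close>

lemma poly_map_cnj: "poly (map_poly cnj q) (cnj z) = cnj (poly q z)"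
  by (induction q) (simp_all add: map_poly_pCons)

lemma poly_map_of_real: "poly (map_poly complex_of_real q) (complex_of_real t) = complex_of_real (poly q t)"
  by (induction q) (simp_all add: map_poly_pCons)

lemma map_cnj_map_of_real: "map_poly cnj (map_poly complex_of_real q) = map_poly complex_of_real q"
  by (induction q) (simp_all add: map_poly_pCons)

lemma map_of_real_add: "map_poly complex_of_real (p + q) = map_poly complex_of_real p + map_poly complex_of_real q"
  by (rule poly_eqI) (simp add: coeff_map_poly)

lemma map_of_real_diff: "map_poly complex_of_real (p - q) = map_poly complex_of_real p - map_poly complex_of_real q"
  by (rule poly_eqI) (simp add: coeff_map_poly)

lemma map_of_real_smult: "map_poly complex_of_real (smult c q) = smult (complex_of_real c) (map_poly complex_of_real q)"
  by (rule poly_eqI) (simp add: coeff_map_poly)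

lemma map_of_real_mult: "map_poly complex_of_real (p * q) = map_poly complex_of_real p * map_poly complex_of_real q"
  by (rule poly_eqI) (simp add: coeff_map_poly coeff_mult)

lemma spectrum_root_bound:
  fixes A :: "'a::chilbert_space \<Rightarrow> 'a"
  assumes A: "sym_op A" and z: "z \<in> spectrum A" and L: "L > 0"
    and root: "poly (map_poly cnj q * q - [:of_real (L\<^sup>2):]) z = 0"
  shows "cmod (poly q z) = L"
proof -
  have "cnj z = z"
    using spectrum_sym_op_real[OF A z] by (simp add: complex_eq_iff)
  then have "poly (map_poly cnj q) z = cnj (poly q z)"
    using poly_map_cnj[of q z] by simp
  then have "of_real ((cmod (poly q z))\<^sup>2) = (of_real (L\<^sup>2) :: complex)"
    using root complex_norm_square[of "poly q z"] by (simp add: mult.commute)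
  then have "(cmod (poly q z))\<^sup>2 = L\<^sup>2"
    by (simp only: of_real_eq_iff)
  then show ?thesis
    using L by (simp add: power2_eq_iff_nonneg)
qed

text \<open>
  The hypothesis \<open>g\<close> excludes that \<open>|q|\<^sup>2\<close> is constant on the real line: the polynomial whose roots are located in the
  spectrum would then be zero, and no particular point of the spectrum would be singled out.
\<close>

lemma spectrum_attains_onorm:
  fixes A :: "'a::chilbert_space \<Rightarrow> 'a"
  assumes A: "sym_op A" and L: "onorm (op_poly q A) > 0"
    and g: "map_poly cnj q * q \<noteq> [:of_real ((onorm (op_poly q A))\<^sup>2):]"
  shows "\<exists>z\<in>spectrum A. cmod (poly q z) = onorm (op_poly q A)"
proof -
  note bA = sym_opD(1)[OF A]
  let ?L = "onorm (op_poly q A)"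
  have "\<not> op_invertible (op_poly (map_poly cnj q * q - [:of_real (?L\<^sup>2):]) A)"
  proof (rule spectrum_attains_norm[OF A L])
    show "norm (op_poly q A x) \<le> ?L * norm x" for x
      by (rule op_poly_least_bound[OF bA])
    fix L' assume L': "\<And>x. norm (op_poly q A x) \<le> L' * norm x"
    have "L' \<ge> 0"
    proof (rule ccontr)
      assume neg: "\<not> L' \<ge> 0"
      have "op_poly q A = (\<lambda>x. 0)"
      proof
        fix x :: 'a
        have "L' * norm x \<le> 0" using neg by (intro mult_nonpos_nonneg) auto
        then have "norm (op_poly q A x) \<le> 0" using L'[of x] by linarith
        then show "op_poly q A x = 0" by simp
      qed
      then show False using L by (simp add: onorm_zero)
    qed
    then show "?L \<le> L'"
      by (intro op_poly_least_bound(2)[OF bA] L')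
  qed
  then obtain z where "z \<in> spectrum A" "poly (map_poly cnj q * q - [:of_real (?L\<^sup>2):]) z = 0"
    using poly_root_in_spectrum[OF bA, of "map_poly cnj q * q - [:of_real (?L\<^sup>2):]"] g by auto
  then show ?thesis
    using spectrum_root_bound[OF A _ L] by blast
qed

text \<open>
  For nonzero \<open>A\<close> the norm is attained on the spectrum by the polynomial \<open>X\<close>; for \<open>A = 0\<close> the spectrum contains \<open>0\<close>.
\<close>

lemma spectrum_nonempty:
  fixes A :: "'a::chilbert_space \<Rightarrow> 'a"
  assumes A: "sym_op A" and x: "(x::'a) \<noteq> 0"
  shows "spectrum A \<noteq> {}"
proof (cases "onorm (op_poly [:0, 1:] A) > 0")
  case True
  have "map_poly cnj [:0, 1:] * [:0, 1:] \<noteq> [:c:]" for c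
    by (simp add: map_poly_pCons)
  then show ?thesis
    using spectrum_attains_onorm[OF A True] by auto
next
  case False
  note bA = sym_opD(1)[OF A]
  have "A y = 0" for y
  proof -
    have "norm (A y) \<le> onorm (op_poly [:0, 1:] A) * norm y"
      using op_poly_least_bound(1)[OF bA, of "[:0, 1:]" y]
      by (simp add: op_poly_linear[OF bA] scaleC_zero_left scaleC_one)
    also have "\<dots> \<le> 0"
      using False by (intro mult_nonpos_nonneg) auto
    finally show ?thesis by simp
  qed
  then have "0 \<in> spectrum A"
    using x by (auto simp: spectrum_def op_invertible_def fun_eq_iff scaleC_zero_left)
  then show ?thesis by auto
qed

text \<open>
  The norm of \<open>q(A)\<close> is \<open>|q(z)|\<close> for some \<open>z\<close> in the spectrum. If \<open>|q|\<^sup>2\<close> is constant on the real line,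
  any point of the spectrum serves, which is why the spectrum has to be nonempty; on the trivial space it is empty, but
  there is nothing to prove.
\<close>

lemma op_poly_norm_le:
  fixes A :: "'a::chilbert_space \<Rightarrow> 'a"
  assumes A: "sym_op A" and b: "0 \<le> b" "\<And>z. z \<in> spectrum A \<Longrightarrow> cmod (poly q z) \<le> b"
  shows "norm (op_poly q A x) \<le> b * norm x"
proof -
  note bA = sym_opD(1)[OF A]
  let ?L = "onorm (op_poly q A)"
  have "?L \<le> b"
  proof (cases "?L > 0")
    case True
    show ?thesis
    proof (cases "map_poly cnj q * q = [:of_real (?L\<^sup>2):]")
      case False
      then obtain z where "z \<in> spectrum A" "cmod (poly q z) = ?L"
        using spectrum_attains_onorm[OF A True] by blast
      then show ?thesis using b(2)[of z] by simp
    next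
      case eq: True
      have "\<exists>x::'a. x \<noteq> 0"
      proof (rule ccontr)
        assume "\<nexists>x::'a. x \<noteq> 0"
        then have "op_poly q A = (\<lambda>x. 0)" by auto
        then show False using True by (simp add: onorm_zero)
      qed
      then obtain z where z: "z \<in> spectrum A"
        using spectrum_nonempty[OF A] by blast
      have "cmod (poly q z) = ?L"
        by (rule spectrum_root_bound[OF A z True]) (simp only: eq diff_self poly_0)
      then show ?thesis using b(2)[OF z] by simp
    qed
  qed (use b in auto)
  then show ?thesis
    using op_poly_least_bound(1)[OF bA, of q x] by (meson mult_right_mono norm_ge_zero order_trans)
qed

section \<open>Existence and uniqueness of the functional calculus\<close>

definition rpoly_op :: "real poly \<Rightarrow> ('a::complex_inner \<Rightarrow> 'a) \<Rightarrow> 'a \<Rightarrow> 'a" where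
  "rpoly_op q A = op_poly (map_poly complex_of_real q) A"

definition cfc :: "(real \<Rightarrow> real) \<Rightarrow> ('a::complex_inner \<Rightarrow> 'a) \<Rightarrow> 'a \<Rightarrow> 'a" where
  "cfc f A = fun_calc (\<lambda>z. complex_of_real (f (Re z))) A"

text \<open>
  A compact superset of the spectrum suffices for approximation and is easier to exhibit than the spectrum itself.
\<close>

definition spec_in :: "('a::complex_inner \<Rightarrow> 'a) \<Rightarrow> real set \<Rightarrow> bool" where
  "spec_in A I \<longleftrightarrow> sym_op A \<and> spectrum A \<subseteq> complex_of_real ` I \<and> compact I"

lemma spec_inD:
  assumes "spec_in A I"
  shows "sym_op A" "bounded_clinear A" "compact I"
  using assms sym_opD(1)[of A] by (auto simp: spec_in_def)

lemma rpoly_op_pCons: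
  assumes "bounded_clinear A"
  shows "rpoly_op (pCons c q) A x = c *\<^sub>R x + A (rpoly_op q A x)"
  by (simp add: rpoly_op_def map_poly_pCons op_poly_pCons[OF assms] scaleR_scaleC)

lemma rpoly_op_0 [simp]: "rpoly_op 0 A x = 0"
  by (simp add: rpoly_op_def)

lemma bounded_clinear_rpoly_op: "bounded_clinear A \<Longrightarrow> bounded_clinear (rpoly_op q A)"
  by (simp add: rpoly_op_def bounded_clinear_op_poly)

lemma rpoly_op_norm_le:
  fixes A :: "'a::chilbert_space \<Rightarrow> 'a"
  assumes A: "spec_in A I" and b: "0 \<le> b" "\<And>t. t \<in> I \<Longrightarrow> \<bar>poly q t\<bar> \<le> b"
  shows "norm (rpoly_op q A x) \<le> b * norm x"
  unfolding rpoly_op_def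
proof (rule op_poly_norm_le[OF spec_inD(1)[OF A] b(1)])
  fix z assume "z \<in> spectrum A"
  then obtain t where "z = complex_of_real t" "t \<in> I"
    using A by (auto simp: spec_in_def)
  then show "cmod (poly (map_poly complex_of_real q) z) \<le> b"
    using b(2)[of t] by (simp add: poly_map_of_real)
qed

text \<open>
  Uniqueness: two sequences of polynomials with the same uniform limit on the spectrum have differences that are
  uniformly small there, so their values at \<open>A\<close> have the same limit.
\<close>

lemma cfc_eqI:
  fixes A B :: "'a::chilbert_space \<Rightarrow> 'a"
  assumes A: "sym_op A" and B: "bounded_clinear B"
    and q: "uniform_limit (spectrum A) (\<lambda>n. poly (q n)) (\<lambda>z. complex_of_real (f (Re z))) sequentially"
    and lim: "(\<lambda>n. onorm (\<lambda>x. op_poly (q n) A x - B x)) \<longlonglongrightarrow> 0"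
  shows "cfc f A = B"
proof -
  note bA = sym_opD(1)[OF A]
  have pt: "(\<lambda>n. op_poly (r n) A x) \<longlonglongrightarrow> C x"
    if C: "bounded_clinear C" and l: "(\<lambda>n. onorm (\<lambda>x. op_poly (r n) A x - C x)) \<longlonglongrightarrow> 0" for r C x
  proof -
    have "bounded_linear (\<lambda>x. op_poly (r n) A x - C x)" for n
      using bounded_clinear_diff[OF bounded_clinear_op_poly[OF bA, of "r n"] C]
      by (simp add: bounded_clinear_def)
    then have a: "norm (op_poly (r n) A x - C x) \<le> onorm (\<lambda>x. op_poly (r n) A x - C x) * norm x" for n
      by (rule onorm)
    have b: "(\<lambda>n. onorm (\<lambda>x. op_poly (r n) A x - C x) * norm x) \<longlonglongrightarrow> 0"
      by (rule tendsto_mult_left_zero[OF l])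
    have "(\<lambda>n. op_poly (r n) A x - C x) \<longlonglongrightarrow> 0"
      by (rule Lim_null_comparison[OF always_eventually[OF allI[OF a]] b])
    then show ?thesis by (simp add: LIM_zero_iff)
  qed
  show ?thesis
    unfolding cfc_def fun_calc_def
  proof (rule the_equality)
    fix C assume "bounded_clinear C \<and> (\<exists>q. uniform_limit (spectrum A) (\<lambda>n. poly (q n))
      (\<lambda>z. complex_of_real (f (Re z))) sequentially \<and>
      (\<lambda>n. onorm (\<lambda>x. op_poly (q n) A x - C x)) \<longlonglongrightarrow> 0)"
    then obtain r where C: "bounded_clinear C"
      and r: "uniform_limit (spectrum A) (\<lambda>n. poly (r n)) (\<lambda>z. complex_of_real (f (Re z))) sequentially"
      and l: "(\<lambda>n. onorm (\<lambda>x. op_poly (r n) A x - C x)) \<longlonglongrightarrow> 0" by auto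
    have u: "uniform_limit (spectrum A) (\<lambda>n z. poly (r n) z - poly (q n) z) (\<lambda>z. 0) sequentially"
      using uniform_limit_minus[OF r q] by simp
    show "C = B"
    proof
      fix x
      have "(\<lambda>n. op_poly (r n) A x - op_poly (q n) A x) \<longlonglongrightarrow> C x - B x"
        by (intro tendsto_diff pt[OF C l] pt[OF B lim])
      moreover have "(\<lambda>n. op_poly (r n) A x - op_poly (q n) A x) \<longlonglongrightarrow> 0"
      proof (rule LIMSEQ_I)
        fix e :: real assume e: "e > 0"
        define d where "d = e / (norm x + 1)"
        have d: "d > 0" using e by (simp add: d_def add_nonneg_pos)
        obtain N where N: "\<And>n z. n \<ge> N \<Longrightarrow> z \<in> spectrum A \<Longrightarrow> cmod (poly (r n) z - poly (q n) z) < d"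
          using u d unfolding uniform_limit_iff eventually_sequentially dist_norm by fastforce
        have "norm (op_poly (r n) A x - op_poly (q n) A x - 0) < e" if "n \<ge> N" for n
        proof -
          have "norm (op_poly (r n - q n) A x) \<le> d * norm x"
            using N[OF that] d by (intro op_poly_norm_le[OF A]) (auto intro: less_imp_le)
          also have "\<dots> < d * (norm x + 1)" using d by simp
          also have "\<dots> = e" by (simp add: d_def add_nonneg_eq_0_iff)
          finally show ?thesis by (simp add: op_poly_diff[OF bA])
        qed
        then show "\<exists>N. \<forall>n\<ge>N. norm (op_poly (r n) A x - op_poly (q n) A x - 0) < e" by blast
      qed
      ultimately have "C x - B x = 0" using LIMSEQ_unique by blast
      then show "C x = B x" by simp
    qed
  qed (use B q lim in blast)
qed

lemma cfc_eqI_approx: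
  fixes A B :: "'a::chilbert_space \<Rightarrow> 'a"
  assumes A: "spec_in A I" and B: "bounded_clinear B"
    and ap: "\<And>e. e > 0 \<Longrightarrow> \<exists>q. (\<forall>t\<in>I. \<bar>poly q t - f t\<bar> \<le> e) \<and> (\<forall>x. norm (rpoly_op q A x - B x) \<le> e * norm x)"
  shows "cfc f A = B"
proof -
  note sA = spec_inD(1)[OF A] and bA = spec_inD(2)[OF A]
  have "\<exists>q. (\<forall>t\<in>I. \<bar>poly q t - f t\<bar> \<le> inverse (real (Suc n))) \<and>
      (\<forall>x. norm (rpoly_op q A x - B x) \<le> inverse (real (Suc n)) * norm x)" for n
    by (rule ap) simp
  then obtain q where q1: "\<And>n t. t \<in> I \<Longrightarrow> \<bar>poly (q n) t - f t\<bar> \<le> inverse (real (Suc n))"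
    and q2: "\<And>n x. norm (rpoly_op (q n) A x - B x) \<le> inverse (real (Suc n)) * norm x"
    by metis
  note lim0 = LIMSEQ_inverse_real_of_nat
  show ?thesis
  proof (rule cfc_eqI[OF sA B, of "\<lambda>n. map_poly complex_of_real (q n)"])
    show "uniform_limit (spectrum A) (\<lambda>n. poly (map_poly complex_of_real (q n)))
       (\<lambda>z. complex_of_real (f (Re z))) sequentially"
    proof (rule uniform_limitI)
      fix e :: real assume "e > 0"
      then have "\<forall>\<^sub>F n in sequentially. inverse (real (Suc n)) < e"
        using order_tendstoD(2)[OF lim0] by blast
      then show "\<forall>\<^sub>F n in sequentially. \<forall>z\<in>spectrum A.
          dist (poly (map_poly complex_of_real (q n)) z) (complex_of_real (f (Re z))) < e"
      proof (eventually_elim, intro ballI)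
        fix n z assume n: "inverse (real (Suc n)) < e" and "z \<in> spectrum A"
        then obtain t where t: "z = complex_of_real t" "t \<in> I"
          using A by (auto simp: spec_in_def)
        then have "dist (poly (map_poly complex_of_real (q n)) z) (complex_of_real (f (Re z)))
            = \<bar>poly (q n) t - f t\<bar>"
          by (simp add: poly_map_of_real dist_norm norm_of_real flip: of_real_diff)
        then show "dist (poly (map_poly complex_of_real (q n)) z) (complex_of_real (f (Re z))) < e"
          using q1[OF t(2), of n] n by linarith
      qed
    qed
    have bl: "bounded_linear (\<lambda>x. op_poly (map_poly complex_of_real (q n)) A x - B x)" for n
      using bounded_clinear_diff[OF bounded_clinear_op_poly[OF bA] B] by (simp add: bounded_clinear_def)
    show "(\<lambda>n. onorm (\<lambda>x. op_poly (map_poly complex_of_real (q n)) A x - B x)) \<longlonglongrightarrow> 0"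
    proof (rule Lim_null_comparison[OF _ lim0])
      have "norm (onorm (\<lambda>x. op_poly (map_poly complex_of_real (q n)) A x - B x)) \<le> inverse (real (Suc n))" for n
        using onorm_pos_le[OF bl[of n]] q2[of n]
        by (simp only: real_norm_def abs_of_nonneg, intro onorm_bound) (simp_all add: rpoly_op_def)
      then show "\<forall>\<^sub>F n in sequentially. norm (onorm (\<lambda>x. op_poly (map_poly complex_of_real (q n)) A x - B x))
         \<le> inverse (real (Suc n))" by (rule always_eventually[OF allI])
    qed
  qed
qed

lemma Weierstrass_poly:
  fixes f :: "real \<Rightarrow> real"
  assumes "compact I" "continuous_on I f" "e > 0"
  shows "\<exists>q. \<forall>t\<in>I. \<bar>poly q t - f t\<bar> < e"
proof -
  obtain g where g: "real_polynomial_function g" "\<And>x. x \<in> I \<Longrightarrow> \<bar>f x - g x\<bar> < e"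
    using Stone_Weierstrass_real_polynomial_function[OF assms] by blast
  obtain a n where gn: "g = (\<lambda>x. \<Sum>i\<le>n. a i * x ^ i)"
    using g(1) unfolding real_polynomial_function_iff_sum by blast
  define q where "q = (\<Sum>i\<le>n. monom (a i) i)"
  have q: "poly q t = g t" for t
    by (simp add: q_def poly_sum poly_monom gn)
  have "\<bar>poly q t - f t\<bar> < e" if "t \<in> I" for t
    using g(2)[OF that] by (simp add: q abs_minus_commute)
  then show ?thesis by blast
qed

text \<open>
  Existence: for polynomials converging uniformly to \<open>f\<close>, the operators \<open>p\<^sub>n(A)\<close> form a Cauchy sequence at every
  vector. The second claim compares the limit with an arbitrary approximating polynomial and is
  the form in which the calculus is used afterwards.
\<close>

lemma cfc_approx:
  fixes A :: "'a::chilbert_space \<Rightarrow> 'a"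
  assumes A: "spec_in A I" and f: "continuous_on I f"
  shows bounded_clinear_cfc: "bounded_clinear (cfc f A)"
    and cfc_close: "0 \<le> e \<Longrightarrow> (\<And>t. t \<in> I \<Longrightarrow> \<bar>poly q t - f t\<bar> \<le> e) \<Longrightarrow>
      norm (rpoly_op q A x - cfc f A x) \<le> e * norm x"
proof -
  note bA = spec_inD(2)[OF A] and cI = spec_inD(3)[OF A]
  have "\<exists>q. \<forall>t\<in>I. \<bar>poly q t - f t\<bar> < inverse (real (Suc n))" for n
    by (rule Weierstrass_poly[OF cI f]) simp
  then obtain p where p: "\<And>n t. t \<in> I \<Longrightarrow> \<bar>poly (p n) t - f t\<bar> < inverse (real (Suc n))"
    by metis
  have rdiff: "rpoly_op q A x - rpoly_op r A x = rpoly_op (q - r) A x" for q r x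
    by (simp add: rpoly_op_def map_of_real_diff op_poly_diff[OF bA])
  have cl: "norm (rpoly_op q A x - rpoly_op (p n) A x) \<le> (e + inverse (real (Suc n))) * norm x"
    if "0 \<le> e" "\<And>t. t \<in> I \<Longrightarrow> \<bar>poly q t - f t\<bar> \<le> e" for q e n x
    unfolding rdiff
  proof (rule rpoly_op_norm_le[OF A])
    fix t assume "t \<in> I"
    then show "\<bar>poly (q - p n) t\<bar> \<le> e + inverse (real (Suc n))"
      using that(2)[OF \<open>t \<in> I\<close>] p[OF \<open>t \<in> I\<close>, of n] unfolding poly_diff by linarith
  qed (use that in simp)
  note lim0 = LIMSEQ_inverse_real_of_nat
  have "Cauchy (\<lambda>n. rpoly_op (p n) A x)" for x
  proof (rule CauchyI)
    fix e :: real assume e: "e > 0"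
    define k where "k = norm x + 1"
    have k: "k > 0" "norm x < k" by (simp_all add: k_def add_nonneg_pos)
    define d where "d = e / (2 * k)"
    have d: "d > 0" using e k by (simp add: d_def)
    obtain N where N: "\<And>n. n \<ge> N \<Longrightarrow> inverse (real (Suc n)) < d"
      using order_tendstoD(2)[OF lim0 d] by (auto simp: eventually_sequentially)
    have "norm (rpoly_op (p m) A x - rpoly_op (p n) A x) < e" if "m \<ge> N" "n \<ge> N" for m n
    proof -
      have "norm (rpoly_op (p m) A x - rpoly_op (p n) A x)
          \<le> (inverse (real (Suc m)) + inverse (real (Suc n))) * norm x"
        using p[of _ m] by (intro cl) (auto intro: less_imp_le)
      also have "\<dots> \<le> (2 * d) * norm x"
        using N[OF that(1)] N[OF that(2)] by (intro mult_right_mono) auto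
      also have "\<dots> < (2 * d) * k" using d k by simp
      also have "\<dots> = e" using k by (simp add: d_def)
      finally show ?thesis .
    qed
    then show "\<exists>M. \<forall>m\<ge>M. \<forall>n\<ge>M. norm (rpoly_op (p m) A x - rpoly_op (p n) A x) < e" by blast
  qed
  then have "\<exists>y. (\<lambda>n. rpoly_op (p n) A x) \<longlonglongrightarrow> y" for x
    using convergent_eq_Cauchy by blast
  then obtain B where B: "\<And>x. (\<lambda>n. rpoly_op (p n) A x) \<longlonglongrightarrow> B x" by metis
  have close: "norm (rpoly_op q A x - B x) \<le> e * norm x"
    if "0 \<le> e" "\<And>t. t \<in> I \<Longrightarrow> \<bar>poly q t - f t\<bar> \<le> e" for q e x
  proof (rule LIMSEQ_le)
    show "(\<lambda>n. norm (rpoly_op q A x - rpoly_op (p n) A x)) \<longlonglongrightarrow> norm (rpoly_op q A x - B x)"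
      by (intro tendsto_norm tendsto_diff tendsto_const B)
    have "(\<lambda>n. (e + inverse (real (Suc n))) * norm x) \<longlonglongrightarrow> (e + 0) * norm x"
      by (intro tendsto_mult tendsto_add tendsto_const lim0)
    then show "(\<lambda>n. (e + inverse (real (Suc n))) * norm x) \<longlonglongrightarrow> e * norm x" by simp
    show "\<exists>N. \<forall>n\<ge>N. norm (rpoly_op q A x - rpoly_op (p n) A x) \<le> (e + inverse (real (Suc n))) * norm x"
      using cl[OF that] by blast
  qed
  have bp: "bounded_clinear (rpoly_op (p n) A)" for n
    by (rule bounded_clinear_rpoly_op[OF bA])
  have bB: "bounded_clinear B"
  proof -
    obtain K where K: "K > 0" "\<And>x. norm (rpoly_op (p 0) A x) \<le> K * norm x"
      using bounded_clinear_bound[OF bp[of 0]] by auto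
    show ?thesis
    proof (rule bounded_clinearI[where K = "K + 1"])
      show "B (x + y) = B x + B y" for x y
      proof (rule LIMSEQ_unique[OF B])
        show "(\<lambda>n. rpoly_op (p n) A (x + y)) \<longlonglongrightarrow> B x + B y"
          using tendsto_add[OF B[of x] B[of y]] by (simp add: bounded_clinearD[OF bp])
      qed
      show "B (a *\<^sub>C x) = a *\<^sub>C B x" for a x
      proof (rule LIMSEQ_unique[OF B])
        have "bounded_linear (\<lambda>x::'a. a *\<^sub>C x)"
          using bounded_clinear_scaleC[OF bounded_clinear_ident] unfolding bounded_clinear_def by blast
        then show "(\<lambda>n. rpoly_op (p n) A (a *\<^sub>C x)) \<longlonglongrightarrow> a *\<^sub>C B x"
          using bounded_linear.tendsto[OF _ B[of x]] by (simp add: bounded_clinearD[OF bp])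
      qed
      show "norm (B x) \<le> (K + 1) * norm x" for x
      proof -
        have "norm (rpoly_op (p 0) A x - B x) \<le> 1 * norm x"
          using p[of _ 0] by (intro close) (auto intro: less_imp_le)
        then show ?thesis
          using K(2)[of x] norm_triangle_ineq4[of "rpoly_op (p 0) A x" "rpoly_op (p 0) A x - B x"]
          by (simp add: algebra_simps)
      qed
    qed
  qed
  have eq: "cfc f A = B"
  proof (rule cfc_eqI_approx[OF A bB])
    fix e :: real assume e: "e > 0"
    obtain q where q: "\<And>t. t \<in> I \<Longrightarrow> \<bar>poly q t - f t\<bar> \<le> e"
      using Weierstrass_poly[OF cI f e] by (auto intro: less_imp_le)
    then show "\<exists>q. (\<forall>t\<in>I. \<bar>poly q t - f t\<bar> \<le> e) \<and> (\<forall>x. norm (rpoly_op q A x - B x) \<le> e * norm x)"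
      using close[of e q] e by (intro exI[of _ q]) auto
  qed
  show "bounded_clinear (cfc f A)" using bB eq by simp
  show "norm (rpoly_op q A x - cfc f A x) \<le> e * norm x"
    if "0 \<le> e" "\<And>t. t \<in> I \<Longrightarrow> \<bar>poly q t - f t\<bar> \<le> e"
    using close[OF that] eq by simp
qed

section \<open>Rules of the functional calculus\<close>

text \<open>
  Letting the argument vary as well makes this apply to compositions, and hence to products of functions.
\<close>

lemma cfc_tendsto:
  fixes A :: "'a::chilbert_space \<Rightarrow> 'a"
  assumes A: "spec_in A I" and f: "continuous_on I f"
    and q: "uniform_limit I (\<lambda>n. poly (q n)) f sequentially" and y: "Y \<longlonglongrightarrow> y"
  shows "(\<lambda>n. rpoly_op (q n) A (Y n)) \<longlonglongrightarrow> cfc f A y"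
proof -
  note bB = bounded_clinear_cfc[OF A f]
  have "bounded_linear (cfc f A)" using bB by (simp add: bounded_clinear_def)
  then have l1: "(\<lambda>n. cfc f A (Y n)) \<longlonglongrightarrow> cfc f A y"
    by (rule bounded_linear.tendsto[OF _ y])
  have "Bseq Y" using y by (intro convergent_imp_Bseq) (auto simp: convergent_def)
  then obtain K where K: "K > 0" "\<And>n. norm (Y n) \<le> K" by (auto elim: BseqE)
  have "(\<lambda>n. rpoly_op (q n) A (Y n) - cfc f A (Y n)) \<longlonglongrightarrow> 0"
  proof (rule tendstoI)
    fix e :: real assume e: "e > 0"
    define d where "d = e / (2 * K)"
    have d: "d > 0" using e K by (simp add: d_def)
    have "\<forall>\<^sub>F n in sequentially. \<forall>t\<in>I. dist (poly (q n) t) (f t) < d"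
      using q d by (auto simp: uniform_limit_iff)
    then show "\<forall>\<^sub>F n in sequentially. dist (rpoly_op (q n) A (Y n) - cfc f A (Y n)) 0 < e"
    proof eventually_elim
      case (elim n)
      have "norm (rpoly_op (q n) A (Y n) - cfc f A (Y n)) \<le> d * norm (Y n)"
        using elim d by (intro cfc_close[OF A f]) (auto simp: dist_real_def intro: less_imp_le)
      also have "\<dots> \<le> d * K" using K d by simp
      also have "\<dots> < e" using K e by (simp add: d_def)
      finally show ?case by simp
    qed
  qed
  from tendsto_add[OF this l1] show ?thesis by simp
qed

lemma cfc_polys:
  fixes f :: "real \<Rightarrow> real"
  assumes "compact I" "continuous_on I f"
  obtains q where "uniform_limit I (\<lambda>n. poly (q n)) f sequentially"
proof -
  have "\<exists>q. \<forall>t\<in>I. \<bar>poly q t - f t\<bar> < inverse (real (Suc n))" for n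
    by (rule Weierstrass_poly[OF assms]) simp
  then obtain p where p: "\<And>n t. t \<in> I \<Longrightarrow> \<bar>poly (p n) t - f t\<bar> < inverse (real (Suc n))"
    by metis
  have "uniform_limit I (\<lambda>n. poly (p n)) f sequentially"
  proof (rule uniform_limitI)
    fix e :: real assume "e > 0"
    then have "\<forall>\<^sub>F n in sequentially. inverse (real (Suc n)) < e"
      using order_tendstoD(2)[OF LIMSEQ_inverse_real_of_nat] by blast
    then show "\<forall>\<^sub>F n in sequentially. \<forall>t\<in>I. dist (poly (p n) t) (f t) < e"
      by eventually_elim (metis p dist_real_def less_trans)
  qed
  then show ?thesis by (rule that)
qed

lemma cfc_poly:
  fixes A :: "'a::chilbert_space \<Rightarrow> 'a"
  assumes A: "spec_in A I"
  shows "cfc (poly q) A = rpoly_op q A"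
proof
  fix x
  have "norm (rpoly_op q A x - cfc (poly q) A x) \<le> 0 * norm x"
    by (rule cfc_close[OF A]) (auto intro: continuous_intros)
  then show "cfc (poly q) A x = rpoly_op q A x" by simp
qed

lemma cfc_eq_limit:
  fixes A :: "'a::chilbert_space \<Rightarrow> 'a"
  assumes A: "spec_in A I" and f: "continuous_on I f"
    and q: "uniform_limit I (\<lambda>n. poly (q n)) f sequentially"
    and lim: "(\<lambda>n. rpoly_op (q n) A x) \<longlonglongrightarrow> y"
  shows "cfc f A x = y"
  using LIMSEQ_unique[OF cfc_tendsto[OF A f q tendsto_const] lim] .

lemma cfc_cong:
  fixes A :: "'a::chilbert_space \<Rightarrow> 'a"
  assumes A: "spec_in A I" and f: "continuous_on I f" and eq: "\<And>t. t \<in> I \<Longrightarrow> f t = g t"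
  shows "cfc f A = cfc g A"
proof
  fix x
  have g: "continuous_on I g" using f eq by (simp cong: continuous_on_cong)
  obtain q where q: "uniform_limit I (\<lambda>n. poly (q n)) f sequentially"
    using cfc_polys[OF spec_inD(3)[OF A] f] .
  then have "uniform_limit I (\<lambda>n. poly (q n)) g sequentially"
    using eq by (simp add: uniform_limit_iff)
  then show "cfc f A x = cfc g A x"
    by (intro cfc_eq_limit[OF A f q] cfc_tendsto[OF A g] tendsto_const)
qed

lemma rpoly_op_add:
  assumes "bounded_clinear A"
  shows "rpoly_op (p + q) A x = rpoly_op p A x + rpoly_op q A x"
  by (simp add: rpoly_op_def map_of_real_add op_poly_add[OF assms])

lemma rpoly_op_smult:
  assumes "bounded_clinear A"
  shows "rpoly_op (smult c q) A x = c *\<^sub>R rpoly_op q A x"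
  by (simp add: rpoly_op_def map_of_real_smult op_poly_smult[OF assms] scaleR_scaleC)

lemma rpoly_op_mult:
  assumes "bounded_clinear A"
  shows "rpoly_op (p * q) A x = rpoly_op p A (rpoly_op q A x)"
  by (simp add: rpoly_op_def map_of_real_mult op_poly_mult[OF assms])

lemma cfc_add:
  fixes A :: "'a::chilbert_space \<Rightarrow> 'a"
  assumes A: "spec_in A I" and f: "continuous_on I f" and g: "continuous_on I g"
  shows "cfc (\<lambda>t. f t + g t) A x = cfc f A x + cfc g A x"
proof -
  obtain p where p: "uniform_limit I (\<lambda>n. poly (p n)) f sequentially"
    using cfc_polys[OF spec_inD(3)[OF A] f] .
  obtain q where q: "uniform_limit I (\<lambda>n. poly (q n)) g sequentially"
    using cfc_polys[OF spec_inD(3)[OF A] g] .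
  show ?thesis
  proof (rule cfc_eq_limit[OF A, of _ "\<lambda>n. p n + q n"])
    show "uniform_limit I (\<lambda>n. poly (p n + q n)) (\<lambda>t. f t + g t) sequentially"
      using uniform_limit_add[OF p q] by (simp add: poly_add[abs_def])
    show "(\<lambda>n. rpoly_op (p n + q n) A x) \<longlonglongrightarrow> cfc f A x + cfc g A x"
      unfolding rpoly_op_add[OF spec_inD(2)[OF A]]
      by (intro tendsto_add cfc_tendsto[OF A f p] cfc_tendsto[OF A g q] tendsto_const)
  qed (intro continuous_intros f g)
qed

lemma cfc_scale:
  fixes A :: "'a::chilbert_space \<Rightarrow> 'a"
  assumes A: "spec_in A I" and f: "continuous_on I f"
  shows "cfc (\<lambda>t. c * f t) A x = c *\<^sub>R cfc f A x"
proof -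
  obtain p where p: "uniform_limit I (\<lambda>n. poly (p n)) f sequentially"
    using cfc_polys[OF spec_inD(3)[OF A] f] .
  show ?thesis
  proof (rule cfc_eq_limit[OF A, of _ "\<lambda>n. smult c (p n)"])
    show "uniform_limit I (\<lambda>n. poly (smult c (p n))) (\<lambda>t. c * f t) sequentially"
      using bounded_linear.uniform_limit[OF bounded_linear_mult_right p, of c] by (simp add: poly_smult[abs_def])
    show "(\<lambda>n. rpoly_op (smult c (p n)) A x) \<longlonglongrightarrow> c *\<^sub>R cfc f A x"
      unfolding rpoly_op_smult[OF spec_inD(2)[OF A]]
      by (intro tendsto_scaleR cfc_tendsto[OF A f p] tendsto_const)
  qed (intro continuous_intros f)
qed

lemma cfc_diff:
  fixes A :: "'a::chilbert_space \<Rightarrow> 'a"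
  assumes A: "spec_in A I" and f: "continuous_on I f" and g: "continuous_on I g"
  shows "cfc (\<lambda>t. f t - g t) A x = cfc f A x - cfc g A x"
  using cfc_add[OF A f, of "\<lambda>t. (-1) * g t" x] cfc_scale[OF A g, of "-1" x] g
  by (simp add: continuous_on_minus)

lemma cfc_mult:
  fixes A :: "'a::chilbert_space \<Rightarrow> 'a"
  assumes A: "spec_in A I" and f: "continuous_on I f" and g: "continuous_on I g"
  shows "cfc (\<lambda>t. f t * g t) A x = cfc f A (cfc g A x)"
proof -
  obtain p where p: "uniform_limit I (\<lambda>n. poly (p n)) f sequentially"
    using cfc_polys[OF spec_inD(3)[OF A] f] .
  obtain q where q: "uniform_limit I (\<lambda>n. poly (q n)) g sequentially"
    using cfc_polys[OF spec_inD(3)[OF A] g] .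
  have b: "bounded (f ` I)" "bounded (g ` I)"
    using compact_continuous_image[OF f spec_inD(3)[OF A]] compact_continuous_image[OF g spec_inD(3)[OF A]]
    by (auto intro: compact_imp_bounded)
  show ?thesis
  proof (rule cfc_eq_limit[OF A, of _ "\<lambda>n. p n * q n"])
    show "uniform_limit I (\<lambda>n. poly (p n * q n)) (\<lambda>t. f t * g t) sequentially"
      using uniform_lim_mult[OF p q b] by (simp add: poly_mult[abs_def])
    show "(\<lambda>n. rpoly_op (p n * q n) A x) \<longlonglongrightarrow> cfc f A (cfc g A x)"
      unfolding rpoly_op_mult[OF spec_inD(2)[OF A]]
      by (intro cfc_tendsto[OF A f p] cfc_tendsto[OF A g q] tendsto_const)
  qed (intro continuous_intros f g)
qed

lemma cfc_const:
  fixes A :: "'a::chilbert_space \<Rightarrow> 'a"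
  assumes A: "spec_in A I"
  shows "cfc (\<lambda>t. c) A x = c *\<^sub>R x"
proof -
  have "poly [:c:] = (\<lambda>t. c)" by auto
  then show ?thesis
    using cfc_poly[OF A, of "[:c:]"]
    by (simp add: rpoly_op_pCons[OF spec_inD(2)[OF A]] bounded_clinearD[OF spec_inD(2)[OF A]])
qed

lemma cfc_id:
  fixes A :: "'a::chilbert_space \<Rightarrow> 'a"
  assumes A: "spec_in A I"
  shows "cfc (\<lambda>t. t) A x = A x"
proof -
  have "poly [:0, 1:] = (\<lambda>t. t::real)" by auto
  then show ?thesis
    using cfc_poly[OF A, of "[:0, 1:]"]
    by (simp add: rpoly_op_pCons[OF spec_inD(2)[OF A]] bounded_clinearD[OF spec_inD(2)[OF A]])
qed

lemma cfc_sum: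
  fixes A :: "'a::chilbert_space \<Rightarrow> 'a"
  assumes A: "spec_in A I" and f: "\<And>k. continuous_on I (f k)"
  shows "cfc (\<lambda>t. \<Sum>k<n::nat. f k t) A x = (\<Sum>k<n. cfc (f k) A x)"
proof (induction n)
  case 0
  then show ?case using cfc_const[OF A, of 0 x] by simp
next
  case (Suc n)
  have "continuous_on I (\<lambda>t. \<Sum>k<n. f k t)" by (intro continuous_intros f)
  from cfc_add[OF A this f[of n]] show ?case using Suc by simp
qed

lemma tendsto_cinner_left:
  fixes X :: "nat \<Rightarrow> 'a::complex_inner"
  assumes "X \<longlonglongrightarrow> x"
  shows "(\<lambda>n. cinner (X n) y) \<longlonglongrightarrow> cinner x y"
proof -
  have "(\<lambda>n. norm (X n - x) * norm y) \<longlonglongrightarrow> 0"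
    using assms by (intro tendsto_mult_left_zero tendsto_norm_zero) (simp add: LIM_zero_iff)
  then have "(\<lambda>n. cinner (X n - x) y) \<longlonglongrightarrow> 0"
    by (rule Lim_null_comparison[rotated]) (simp add: Cauchy_Schwarz)
  then show ?thesis by (simp add: cinner_diff_left LIM_zero_iff)
qed

lemma tendsto_cinner_right:
  fixes X :: "nat \<Rightarrow> 'a::complex_inner"
  assumes "X \<longlonglongrightarrow> x"
  shows "(\<lambda>n. cinner y (X n)) \<longlonglongrightarrow> cinner y x"
  unfolding cinner_commute[of y] by (intro tendsto_cnj tendsto_cinner_left assms)

lemma sym_op_cfc:
  fixes A :: "'a::chilbert_space \<Rightarrow> 'a"
  assumes A: "spec_in A I" and f: "continuous_on I f"
  shows "sym_op (cfc f A)"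
  unfolding sym_op_def
proof (intro conjI allI bounded_clinear_cfc[OF A f])
  fix x y
  obtain p where p: "uniform_limit I (\<lambda>n. poly (p n)) f sequentially"
    using cfc_polys[OF spec_inD(3)[OF A] f] .
  have "cinner (rpoly_op (p n) A x) y = cinner x (rpoly_op (p n) A y)" for n
    by (simp add: rpoly_op_def cinner_op_poly[OF spec_inD(1)[OF A]] map_cnj_map_of_real)
  moreover have "(\<lambda>n. cinner (rpoly_op (p n) A x) y) \<longlonglongrightarrow> cinner (cfc f A x) y"
    by (intro tendsto_cinner_left cfc_tendsto[OF A f p] tendsto_const)
  moreover have "(\<lambda>n. cinner x (rpoly_op (p n) A y)) \<longlonglongrightarrow> cinner x (cfc f A y)"
    by (intro tendsto_cinner_right cfc_tendsto[OF A f p] tendsto_const)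
  ultimately show "cinner (cfc f A x) y = cinner x (cfc f A y)"
    by (simp add: LIMSEQ_unique)
qed

lemma cfc_commute:
  fixes A :: "'a::chilbert_space \<Rightarrow> 'a"
  assumes A: "spec_in A I" and f: "continuous_on I f"
    and D: "bounded_clinear D" and c: "\<And>x. D (A x) = A (D x)"
  shows "D (cfc f A x) = cfc f A (D x)"
proof -
  obtain p where p: "uniform_limit I (\<lambda>n. poly (p n)) f sequentially"
    using cfc_polys[OF spec_inD(3)[OF A] f] .
  have bl: "bounded_linear D" using D by (simp add: bounded_clinear_def)
  have "(\<lambda>n. D (rpoly_op (p n) A x)) \<longlonglongrightarrow> D (cfc f A x)"
    by (intro bounded_linear.tendsto[OF bl] cfc_tendsto[OF A f p] tendsto_const)
  moreover have "D (rpoly_op (p n) A x) = rpoly_op (p n) A (D x)" for n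
    unfolding rpoly_op_def by (rule op_poly_commute[OF spec_inD(2)[OF A] D c])
  ultimately show ?thesis
    using cfc_eq_limit[OF A f p, of "D x"] by simp
qed

text \<open>
  A nonnegative function is the square of its square root, and the value of the calculus at the root is self-adjoint.
\<close>

lemma cfc_nonneg:
  fixes A :: "'a::chilbert_space \<Rightarrow> 'a"
  assumes A: "spec_in A I" and f: "continuous_on I f" and nn: "\<And>t. t \<in> I \<Longrightarrow> 0 \<le> f t"
  shows "pos_op (cfc f A)"
  unfolding pos_op_def
proof (intro conjI allI sym_op_cfc[OF A f])
  fix x
  have s: "continuous_on I (\<lambda>t. sqrt (f t))" by (intro continuous_intros f)
  have "cfc f A x = cfc (\<lambda>t. sqrt (f t) * sqrt (f t)) A x"
    by (rule fun_cong[OF cfc_cong[OF A f]]) (simp add: nn)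
  also have "\<dots> = cfc (\<lambda>t. sqrt (f t)) A (cfc (\<lambda>t. sqrt (f t)) A x)"
    by (rule cfc_mult[OF A s s])
  finally have "cinner (cfc f A x) x = cinner (cfc (\<lambda>t. sqrt (f t)) A x) (cfc (\<lambda>t. sqrt (f t)) A x)"
    by (simp only: sym_opD(2)[OF sym_op_cfc[OF A s], of "cfc (\<lambda>t. sqrt (f t)) A x" x])
  then show "0 \<le> Re (cinner (cfc f A x) x)"
    by (simp add: cinner_self_eq)
qed

lemma cfc_mono:
  fixes A :: "'a::chilbert_space \<Rightarrow> 'a"
  assumes A: "spec_in A I" and f: "continuous_on I f" and g: "continuous_on I g"
    and le: "\<And>t. t \<in> I \<Longrightarrow> f t \<le> g t"
  shows "Re (cinner (cfc f A x) x) \<le> Re (cinner (cfc g A x) x)"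
proof -
  have "pos_op (cfc (\<lambda>t. g t - f t) A)"
    by (rule cfc_nonneg[OF A]) (auto intro: continuous_on_diff f g simp: le)
  then have "0 \<le> Re (cinner (cfc (\<lambda>t. g t - f t) A x) x)" by (simp add: pos_op_def)
  then show ?thesis by (simp add: cfc_diff[OF A g f] cinner_diff_left)
qed

lemma norm_cfc_sq:
  fixes A :: "'a::chilbert_space \<Rightarrow> 'a"
  assumes A: "spec_in A I" and f: "continuous_on I f"
  shows "(norm (cfc f A x))\<^sup>2 = Re (cinner (cfc (\<lambda>t. (f t)\<^sup>2) A x) x)"
  by (simp only: power2_eq_square[of "f _"] cfc_mult[OF A f f]
      sym_opD(2)[OF sym_op_cfc[OF A f], of "cfc f A x" x] norm_sq_cinner)

lemma norm_cfc_mono: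
  fixes A :: "'a::chilbert_space \<Rightarrow> 'a"
  assumes A: "spec_in A I" and f: "continuous_on I f" and g: "continuous_on I g"
    and le: "\<And>t. t \<in> I \<Longrightarrow> \<bar>f t\<bar> \<le> \<bar>g t\<bar>"
  shows "norm (cfc f A x) \<le> norm (cfc g A x)"
proof (rule power2_le_imp_le)
  show "(norm (cfc f A x))\<^sup>2 \<le> (norm (cfc g A x))\<^sup>2"
    unfolding norm_cfc_sq[OF A f] norm_cfc_sq[OF A g]
    by (rule cfc_mono[OF A]) (auto intro!: continuous_intros f g simp: le abs_le_square_iff[symmetric])
qed simp

section \<open>Operators that are small on spectral slices\<close>

text \<open>
  The vectors \<open>u\<close> in the premise are those that \<open>S\<close> treats as eigenvectors for \<open>s\<close> up to an error of size \<open>d\<close>.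
  A partition of unity on \<open>[-M, M]\<close> into \<open>N + 1\<close> bumps \<open>\<phi>\<^sub>k\<close> of width \<open>d = 2 M / N\<close> splits \<open>x\<close> into such vectors
  \<open>\<phi>\<^sub>k(S) x\<close>. The sum of their squared norms is at most \<open>\<parallel>x\<parallel>\<^sup>2\<close>, so by the Cauchy--Schwarz inequality the sum of their
  norms is only \<open>O(\<surd>N)\<close>, while \<open>Z\<close> contributes a factor \<open>K d = O(1 / N)\<close>.
\<close>

lemma zero_by_spectral_slices:
  fixes S Z :: "'a::chilbert_space \<Rightarrow> 'a"
  assumes S: "sym_op S" and Z: "bounded_clinear Z"
    and M: "M > 0" "\<And>x. norm (S x) \<le> M * norm x"
    and slice: "\<And>s d u. \<bar>s\<bar> \<le> M \<Longrightarrow> d > 0 \<Longrightarrow>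
        norm (S (S u - s *\<^sub>R u) - s *\<^sub>R (S u - s *\<^sub>R u)) \<le> d\<^sup>2 * norm u \<Longrightarrow> norm (Z u) \<le> K * d * norm u"
    and K: "K \<ge> 0"
  shows "Z x = 0"
proof -
  let ?I = "{-M..M}"
  have A: "spec_in S ?I"
    unfolding spec_in_def
  proof (intro conjI S compact_Icc subsetI)
    fix z assume z: "z \<in> spectrum S"
    have "Im z = 0" by (rule spectrum_sym_op_real[OF S z])
    moreover have "\<bar>Re z\<bar> \<le> M"
      using spectrum_norm_le[OF S M(2) z] abs_Re_le_cmod[of z] by linarith
    ultimately show "z \<in> complex_of_real ` ?I"
      by (intro image_eqI[of _ _ "Re z"]) (auto simp: complex_eq_iff)
  qed
  have bound: "norm (Z x) \<le> K * (2 * M / real N) * (sqrt (real (N + 1)) * norm x)" if N: "N > 0" for N :: nat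
  proof -
    define d where "d = 2 * M / real N"
    have d: "d > 0" using M N by (simp add: d_def)
    have Nd: "real N * d = 2 * M" using N by (simp add: d_def)
    define s where "s k = - M + real k * d" for k :: nat
    \<comment> \<open>Ramps decreasing in \<open>k\<close>; as the bumps are their consecutive differences, the sum of the bumps telescopes.\<close>
    define h where "h k t = min 1 (max 0 (1 + (t - s k) / d))" for k t
    define \<phi> where "\<phi> k t = h k t - h (Suc k) t" for k t
    have hc: "continuous_on ?I (h k)" for k
      unfolding h_def using d by (intro continuous_intros) auto
    have \<phi>c: "continuous_on ?I (\<phi> k)" for k
      unfolding \<phi>_def by (intro continuous_intros hc)
    have sS: "s (Suc k) = s k + d" for k by (simp add: s_def algebra_simps)
    have hS: "h (Suc k) t = min 1 (max 0 ((t - s k) / d))" for k t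
      using d by (simp add: h_def sS field_simps)
    have \<phi>0: "0 \<le> \<phi> k t" "\<phi> k t \<le> 1" for k t
      unfolding \<phi>_def hS by (auto simp: h_def)
    have supp: "\<phi> k t = 0" if "\<bar>t - s k\<bar> > d" for k t
    proof -
      have "(t - s k) / d > 1 \<or> (t - s k) / d < -1"
        using that d by (auto simp: field_simps)
      then show ?thesis unfolding \<phi>_def hS by (auto simp: h_def)
    qed
    have tot: "(\<Sum>k<N+1. \<phi> k t) = 1" if "t \<in> ?I" for t
    proof -
      have "(\<Sum>k<N+1. \<phi> k t) = h 0 t - h (N+1) t"
        unfolding \<phi>_def using sum_lessThan_telescope'[of "\<lambda>k. h k t" "N+1"] by simp
      moreover have "(t - s 0) / d \<ge> 0" using that d by (simp add: s_def)
      then have "h 0 t = 1" by (simp add: h_def)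
      moreover have "s N = M" using Nd by (simp add: s_def)
      then have "(t - s N) / d \<le> 0" using that d by (simp add: divide_nonpos_pos)
      then have "h (N+1) t = 0" using hS[of N t] by simp
      ultimately show ?thesis by simp
    qed
    define F where "F k = cfc (\<phi> k) S" for k
    have dec: "x = (\<Sum>k<N+1. F k x)"
    proof -
      have "(\<Sum>k<N+1. F k x) = cfc (\<lambda>t. \<Sum>k<N+1. \<phi> k t) S x"
        unfolding F_def by (rule cfc_sum[OF A \<phi>c, symmetric])
      also have "cfc (\<lambda>t. \<Sum>k<N+1. \<phi> k t) S = cfc (\<lambda>t. 1) S"
        by (rule cfc_cong[OF A]) (use \<phi>c tot in \<open>auto intro!: continuous_intros\<close>)
      finally show ?thesis by (simp add: cfc_const[OF A])
    qed
    have Zk: "norm (Z (F k x)) \<le> K * d * norm (F k x)" if k: "k < N + 1" for k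
    proof (rule slice[OF _ d])
      have "real k * d \<le> real N * d" using k d by (intro mult_right_mono) auto
      moreover have "0 \<le> real k * d" using d by simp
      ultimately show "\<bar>s k\<bar> \<le> M" using Nd unfolding s_def by linarith
      have c1: "continuous_on ?I (\<lambda>t. t - s k)" by (intro continuous_intros)
      have one: "cfc (\<lambda>t. t - s k) S v = S v - s k *\<^sub>R v" for v
        using cfc_diff[OF A, of "\<lambda>t. t" "\<lambda>t. s k" v]
        by (simp add: cfc_id[OF A] cfc_const[OF A] continuous_on_id)
      have "S (S (F k x) - s k *\<^sub>R F k x) - s k *\<^sub>R (S (F k x) - s k *\<^sub>R F k x)
          = cfc (\<lambda>t. (t - s k) * ((t - s k) * \<phi> k t)) S x"
        using cfc_mult[OF A c1 continuous_on_mult[OF c1 \<phi>c[of k]], of x] cfc_mult[OF A c1 \<phi>c[of k], of x]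
        by (simp add: one F_def)
      also have "norm \<dots> \<le> norm (cfc (\<lambda>t. d\<^sup>2 * \<phi> k t) S x)"
      proof (rule norm_cfc_mono[OF A])
        fix t
        show "\<bar>(t - s k) * ((t - s k) * \<phi> k t)\<bar> \<le> \<bar>d\<^sup>2 * \<phi> k t\<bar>"
        proof (cases "\<bar>t - s k\<bar> > d")
          case False
          then have "(t - s k) * (t - s k) \<le> d\<^sup>2"
            using d abs_le_square_iff[of "t - s k" d] by (simp add: power2_eq_square)
          then have "((t - s k) * (t - s k)) * \<phi> k t \<le> d\<^sup>2 * \<phi> k t"
            using \<phi>0 by (intro mult_right_mono) auto
          then show ?thesis using \<phi>0 by (simp add: abs_mult mult.assoc)
        qed (use supp in simp)
      qed (intro continuous_intros \<phi>c)+
      also have "\<dots> = d\<^sup>2 * norm (F k x)"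
        by (simp add: cfc_scale[OF A \<phi>c] F_def)
      finally show "norm (S (S (F k x) - s k *\<^sub>R F k x) - s k *\<^sub>R (S (F k x) - s k *\<^sub>R F k x))
          \<le> d\<^sup>2 * norm (F k x)" .
    qed
    have "(\<Sum>k<N+1. (norm (F k x))\<^sup>2) \<le> (\<Sum>k<N+1. Re (cinner (F k x) x))"
      unfolding F_def norm_cfc_sq[OF A \<phi>c]
      by (intro sum_mono cfc_mono[OF A] continuous_intros \<phi>c)
        (use \<phi>0 in \<open>auto simp: power2_eq_square intro: mult_left_le_one_le\<close>)
    also have "\<dots> = Re (cinner (\<Sum>k<N+1. F k x) x)"
    proof -
      have "cinner (\<Sum>k<n. F k x) x = (\<Sum>k<n. cinner (F k x) x)" for n :: nat
        by (induction n) (simp_all add: cinner_add_left)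
      then show ?thesis by (simp only: Re_sum)
    qed
    also have "\<dots> = (norm x)\<^sup>2" by (simp only: dec[symmetric] norm_sq_cinner)
    finally have sq: "(\<Sum>k<N+1. (norm (F k x))\<^sup>2) \<le> (norm x)\<^sup>2" .
    have "norm (Z x) = norm (\<Sum>k<N+1. Z (F k x))"
      using dec linear_sum[of Z "\<lambda>k. F k x" "{..<N+1}"] Z
      by (metis bounded_clinear_def bounded_linear.linear)
    also have "\<dots> \<le> (\<Sum>k<N+1. norm (Z (F k x)))" by (rule norm_sum)
    also have "\<dots> \<le> (\<Sum>k<N+1. K * d * norm (F k x))" by (intro sum_mono Zk) auto
    also have "\<dots> = K * d * (\<Sum>k<N+1. 1 * norm (F k x))" by (simp add: sum_distrib_left del: sum.lessThan_Suc)
    also have "\<dots> \<le> K * d * (sqrt (real (N + 1)) * norm x)"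
    proof (intro mult_left_mono)
      have "(\<Sum>k<N+1. 1 * norm (F k x)) \<le> L2_set (\<lambda>k. 1) {..<N+1} * L2_set (\<lambda>k. norm (F k x)) {..<N+1}"
        by (rule order_trans[OF _ L2_set_mult_ineq]) simp
      also have "\<dots> \<le> sqrt (real (N + 1)) * norm x"
      proof (rule mult_mono)
        show "L2_set (\<lambda>k. norm (F k x)) {..<N+1} \<le> norm x"
          unfolding L2_set_def using real_sqrt_le_mono[OF sq] by simp
        show "L2_set (\<lambda>k. 1) {..<N+1} \<le> sqrt (real (N + 1))" by (simp add: L2_set_def)
      qed (simp_all add: L2_set_nonneg del: sum.lessThan_Suc)
      finally show "(\<Sum>k<N+1. 1 * norm (F k x)) \<le> sqrt (real (N + 1)) * norm x" .
    qed (use K d in auto)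
    finally show ?thesis by (simp add: d_def)
  qed
  have "(\<lambda>N. sqrt (real (N + 1)) / real N) \<longlonglongrightarrow> 0" by real_asymp
  then have "(\<lambda>N. K * 2 * M * norm x * (sqrt (real (N + 1)) / real N)) \<longlonglongrightarrow> 0"
    by (rule tendsto_mult_right_zero)
  moreover have "\<forall>\<^sub>F N in sequentially. norm (Z x) \<le> K * 2 * M * norm x * (sqrt (real (N + 1)) / real N)"
    using eventually_gt_at_top[of "0::nat"]
  proof eventually_elim
    case (elim N)
    then show ?case using bound[of N] by (simp add: mult_ac)
  qed
  ultimately have "norm (Z x) \<le> 0"
    by (rule tendsto_lowerbound) simp
  then show ?thesis by simp
qed

section \<open>A family of positive operators that forces commutation\<close>

lemma bounded_clinear_common_bound:
  assumes "bounded_clinear J" "bounded_clinear C"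
  obtains M where "M \<ge> 1" "\<And>x. norm (J x) \<le> M * norm x" "\<And>x. norm (C x) \<le> M * norm x"
proof -
  obtain K where K: "K > 0" "\<And>x. norm (J x) \<le> K * norm x"
    using bounded_clinear_bound[OF assms(1)] by auto
  obtain L where L: "L > 0" "\<And>x. norm (C x) \<le> L * norm x"
    using bounded_clinear_bound[OF assms(2)] by auto
  show ?thesis
  proof (rule that)
    show "max 1 (max K L) \<ge> 1" by simp
    show "norm (J x) \<le> max 1 (max K L) * norm x" for x
      by (rule order_trans[OF K(2) mult_right_mono]) auto
    show "norm (C x) \<le> max 1 (max K L) * norm x" for x
      by (rule order_trans[OF L(2) mult_right_mono]) auto
  qed
qed

text \<open>
  Being in a slice is formulated through the square of \<open>J - s\<close>, because second order smallness is what the estimates below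
  consume; smallness of first order is a consequence.
\<close>

lemma sym_op_shift_norm_le:
  fixes J :: "'a::complex_inner \<Rightarrow> 'a"
  assumes J: "sym_op J" and d: "d > 0"
    and sl: "norm (J (J u - s *\<^sub>R u) - s *\<^sub>R (J u - s *\<^sub>R u)) \<le> d\<^sup>2 * norm u"
  shows "norm (J u - s *\<^sub>R u) \<le> d * norm u"
proof (rule power2_le_imp_le)
  define R where "R x = J x - s *\<^sub>R x" for x
  have "(norm (R u))\<^sup>2 = Re (cinner (R (R u)) u)"
    by (simp add: norm_sq_cinner R_def cinner_simps sym_opD(2)[OF J])
  also have "\<dots> \<le> norm (R (R u)) * norm u" by (rule Cauchy_Schwarz_Re)
  also have "\<dots> \<le> (d\<^sup>2 * norm u) * norm u"
    using sl by (intro mult_right_mono) (auto simp: R_def)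
  finally show "(norm (J u - s *\<^sub>R u))\<^sup>2 \<le> (d * norm u)\<^sup>2"
    by (simp add: R_def power_mult_distrib power2_eq_square mult_ac)
qed (use d in auto)

text \<open>
  Write \<open>R = J - s\<close> and \<open>P = J + s\<close>, and let \<open>G\<close> be the positive operator for \<open>m = s\<^sup>2\<close>. Then
  \<open>G = R P C P R + s\<^sup>2 Z\<close>, where \<open>Z\<close> is the double commutator of \<open>J\<close> with \<open>C\<close>. The double
  commutator does not change when \<open>J\<close> is replaced by \<open>R\<close>, so the form of \<open>G\<close> is of second order in \<open>R\<close> and \<open>\<langle>G u, u\<rangle> = O(d\<^sup>2)\<close>. As
  \<open>G\<close> is positive, \<open>\<parallel>G u\<parallel> = O(d)\<close>, and the decomposition of \<open>G\<close> gives \<open>s\<^sup>2 \<parallel>Z u\<parallel> = O(d)\<close>.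
  Since \<open>J\<^sup>2\<close> is close to \<open>s\<^sup>2\<close> on \<open>u\<close>, the factor \<open>s\<^sup>2\<close>, which depends on the slice,
  can be traded for the fixed operator \<open>J\<^sup>2\<close>.
\<close>

lemma double_commutator_slice:
  fixes J C :: "'a::chilbert_space \<Rightarrow> 'a"
  assumes J: "sym_op J" and C: "pos_op C" and M: "M \<ge> 1"
    and JM: "\<And>x. norm (J x) \<le> M * norm x" and CM: "\<And>x. norm (C x) \<le> M * norm x"
    and pos: "\<And>w m. 0 \<le> m \<Longrightarrow>
      0 \<le> Re (cinner (C (J (J w))) (J (J w))) - 2 * m * Re (cinner (C (J w)) (J w)) + m\<^sup>2 * Re (cinner (C w) w)"
    and s: "\<bar>s\<bar> \<le> M" and d: "d > 0"
    and sl: "norm (J (J u - s *\<^sub>R u) - s *\<^sub>R (J u - s *\<^sub>R u)) \<le> d\<^sup>2 * norm u"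
    and Z: "\<And>x. Z x = J (J (C x)) - 2 *\<^sub>R J (C (J x)) + C (J (J x))"
  shows "norm (Z (J (J u))) \<le> 21 * M ^ 4 * d * norm u"
proof -
  have sC: "sym_op C" and nnC: "\<And>x. 0 \<le> Re (cinner (C x) x)" using C by (auto simp: pos_op_def)
  note bJ = sym_opD(1)[OF J] and bC = sym_opD(1)[OF sC]
  note Jl = bounded_clinearD[OF bJ] and Cl = bounded_clinearD[OF bC]
  note Js = sym_opD(2)[OF J] and Cs = sym_opD(2)[OF sC]
  have M0: "M > 0" using M by simp
  define R where "R x = J x - s *\<^sub>R x" for x
  define P where "P x = J x + s *\<^sub>R x" for x
  have bR: "bounded_clinear R" and bP: "bounded_clinear P"
    unfolding R_def P_def by (intro bounded_clinear_intros bJ)+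
  note Rl = bounded_clinearD[OF bR] and Pl = bounded_clinearD[OF bP]
  have Rs: "cinner (R x) y = cinner x (R y)" for x y
    by (simp add: R_def cinner_simps Js)
  have Ps: "cinner (P x) y = cinner x (P y)" for x y
    by (simp add: P_def cinner_simps Js)
  have sM: "norm (s *\<^sub>R x) \<le> M * norm x" for x :: 'a
    using s by (simp add: mult_right_mono)
  have RM: "norm (R x) \<le> 2 * M * norm x" for x
    using norm_triangle_ineq4[of "J x" "s *\<^sub>R x"] JM[of x] sM[of x] by (simp add: R_def)
  have PM: "norm (P x) \<le> 2 * M * norm x" for x
    using norm_triangle_ineq[of "J x" "s *\<^sub>R x"] JM[of x] sM[of x] by (simp add: P_def)
  have RP: "J (J x) - s\<^sup>2 *\<^sub>R x = P (R x)" "P (R x) = R (P x)" for x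
    by (simp_all add: R_def P_def Jl algebra_simps power2_eq_square)
  have R2: "norm (R (R u)) \<le> d\<^sup>2 * norm u" using sl by (simp add: R_def)
  have R1: "norm (R u) \<le> d * norm u"
    using sym_op_shift_norm_le[OF J d sl] by (simp add: R_def)
  have Z_alt: "Z x = R (R (C x)) - 2 *\<^sub>R R (C (R x)) + C (R (R x))" for x
    unfolding Z R_def scaleR_2 by (simp add: Jl Cl algebra_simps)
  define G where "G x = J (J (C (J (J x)))) - (2 * s\<^sup>2) *\<^sub>R J (C (J x)) + (s\<^sup>2)\<^sup>2 *\<^sub>R C x" for x
  have G_alt: "G x = R (P (C (P (R x)))) + s\<^sup>2 *\<^sub>R Z x" for x
    unfolding RP[symmetric] unfolding G_def Z
    by (simp add: Jl Cl algebra_simps power2_eq_square)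
  note comp = bounded_clinear_compose
  have bG: "bounded_clinear G"
    unfolding G_def
    by (intro bounded_clinear_intros comp[OF bJ comp[OF bJ comp[OF bC comp[OF bJ bJ]]]]
        comp[OF bJ comp[OF bC bJ]] bC)
  have posG: "pos_op G"
    unfolding pos_op_def sym_op_def
  proof (intro conjI allI bG)
    show "cinner (G x) y = cinner x (G y)" for x y
      by (simp add: G_def cinner_simps Js Cs)
    show "0 \<le> Re (cinner (G x) x)" for x
      using pos[of "s\<^sup>2" x] by (simp add: G_def cinner_simps Js)
  qed
  have JM': "norm (J x) \<le> M * c" if "norm x \<le> c" for x c
    using JM[of x] that M0 by (meson mult_left_mono less_imp_le order_trans)
  have CM': "norm (C x) \<le> M * c" if "norm x \<le> c" for x c
    using CM[of x] that M0 by (meson mult_left_mono less_imp_le order_trans)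
  have RM': "norm (R x) \<le> 2 * M * c" if "norm x \<le> c" for x c
    using RM[of x] that M0 by (smt (verit) mult_left_mono)
  have PM': "norm (P x) \<le> 2 * M * c" if "norm x \<le> c" for x c
    using PM[of x] that M0 by (smt (verit) mult_left_mono)
  have s2: "s\<^sup>2 \<le> M\<^sup>2" using s by (simp add: abs_le_square_iff[symmetric] M0 less_imp_le)
  have M34: "M ^ 3 \<le> M ^ 4" "M ^ 4 \<le> M ^ 5" using M by (simp_all add: power_increasing)
  have Gn: "norm (G x) \<le> 4 * M ^ 5 * norm x" for x
  proof -
    have a: "norm (J (J (C (J (J x))))) \<le> M * (M * (M * (M * (M * norm x))))"
      by (intro JM' CM') simp
    have b: "norm ((2 * s\<^sup>2) *\<^sub>R J (C (J x))) \<le> (2 * M\<^sup>2) * (M * (M * (M * norm x)))"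
      unfolding norm_scaleR using s2 M0 by (intro mult_mono JM' CM') auto
    have c: "norm ((s\<^sup>2)\<^sup>2 *\<^sub>R C x) \<le> (M\<^sup>2)\<^sup>2 * (M * norm x)"
      unfolding norm_scaleR using power_mono[OF s2, of 2] M0 by (intro mult_mono CM') auto
    have "norm (G x) \<le> norm (J (J (C (J (J x))))) + norm ((2 * s\<^sup>2) *\<^sub>R J (C (J x))) + norm ((s\<^sup>2)\<^sup>2 *\<^sub>R C x)"
      unfolding G_def by (intro order_trans[OF norm_triangle_ineq] add_right_mono norm_triangle_ineq4)
    also have "\<dots> \<le> M * (M * (M * (M * (M * norm x)))) + (2 * M\<^sup>2) * (M * (M * (M * norm x))) + (M\<^sup>2)\<^sup>2 * (M * norm x)"
      by (intro add_mono a b c)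
    also have "\<dots> = 4 * M ^ 5 * norm x" by (simp add: algebra_simps power_numeral_reduce)
    finally show ?thesis .
  qed
  have Guu: "Re (cinner (G u) u) \<le> 6 * M ^ 3 * d\<^sup>2 * (norm u)\<^sup>2"
  proof -
    have "Re (cinner (R (P (C (P (R u))))) u) = Re (cinner (C (P (R u))) (P (R u)))"
      by (simp add: Rs Ps RP(2))
    also have "\<dots> \<le> norm (C (P (R u))) * norm (P (R u))" by (rule Cauchy_Schwarz_Re)
    also have "\<dots> \<le> (M * (2 * M * (d * norm u))) * (2 * M * (d * norm u))"
      using M0 d by (intro mult_mono CM' PM' R1) auto
    finally have 1: "Re (cinner (R (P (C (P (R u))))) u) \<le> 4 * M ^ 3 * d\<^sup>2 * (norm u)\<^sup>2"
      by (simp add: power2_eq_square power3_eq_cube mult_ac)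
    have "Re (cinner (Z u) u) = 2 * Re (cinner (C u) (R (R u))) - 2 * Re (cinner (C (R u)) (R u))"
      using Re_cinner_commute[of "C (R (R u))" u]
      by (simp add: Z_alt cinner_simps Rs Cs)
    also have "\<dots> \<le> 2 * (norm (C u) * norm (R (R u)))"
      using nnC[of "R u"] Cauchy_Schwarz_Re[of "C u" "R (R u)"] by linarith
    also have "\<dots> \<le> 2 * ((M * norm u) * (d\<^sup>2 * norm u))"
      using M0 by (intro mult_left_mono mult_mono CM R2) auto
    finally have z: "Re (cinner (Z u) u) \<le> 2 * M * d\<^sup>2 * (norm u)\<^sup>2"
      by (simp add: power2_eq_square mult_ac)
    have "s\<^sup>2 * Re (cinner (Z u) u) \<le> s\<^sup>2 * (2 * M * d\<^sup>2 * (norm u)\<^sup>2)"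
      by (intro mult_left_mono z) simp
    also have "\<dots> \<le> M\<^sup>2 * (2 * M * d\<^sup>2 * (norm u)\<^sup>2)"
      using M0 by (intro mult_right_mono s2) simp
    finally have 2: "s\<^sup>2 * Re (cinner (Z u) u) \<le> 2 * M ^ 3 * d\<^sup>2 * (norm u)\<^sup>2"
      by (simp add: power2_eq_square power3_eq_cube mult_ac)
    have "Re (cinner (G u) u) = Re (cinner (R (P (C (P (R u))))) u) + s\<^sup>2 * Re (cinner (Z u) u)"
      by (simp only: G_alt cinner_simps) simp
    then show ?thesis using 1 2 by linarith
  qed
  have Gu: "norm (G u) \<le> 5 * M ^ 4 * d * norm u"
  proof (rule power2_le_imp_le)
    have "(norm (G u))\<^sup>2 \<le> (4 * M ^ 5) * Re (cinner (G u) u)"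
      by (rule pos_op_norm_sq_le[OF posG _ Gn]) (use M0 in simp)
    also have "\<dots> \<le> (4 * M ^ 5) * (6 * M ^ 3 * d\<^sup>2 * (norm u)\<^sup>2)"
      using M0 by (intro mult_left_mono Guu) auto
    also have "\<dots> = 24 * (M ^ 4 * d * norm u)\<^sup>2"
      by (simp add: power_mult_distrib power2_eq_square power_numeral_reduce mult_ac)
    also have "\<dots> \<le> 25 * (M ^ 4 * d * norm u)\<^sup>2" by simp
    also have "\<dots> = (5 * M ^ 4 * d * norm u)\<^sup>2" by (simp add: power_mult_distrib)
    finally show "(norm (G u))\<^sup>2 \<le> (5 * M ^ 4 * d * norm u)\<^sup>2" .
  qed (use M0 d in auto)
  have "norm (R (P (C (P (R u))))) \<le> 2 * M * (2 * M * (M * (2 * M * (d * norm u))))"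
    by (intro RM' PM' CM' R1)
  then have f: "norm (R (P (C (P (R u))))) \<le> 8 * M ^ 4 * d * norm u"
    by (simp add: power_numeral_reduce mult_ac)
  have sZ: "norm (s\<^sup>2 *\<^sub>R Z u) \<le> 13 * M ^ 4 * d * norm u"
  proof -
    have "s\<^sup>2 *\<^sub>R Z u = G u - R (P (C (P (R u))))"
      by (simp add: G_alt)
    then show ?thesis
      using norm_triangle_ineq4[of "G u" "R (P (C (P (R u))))"] Gu f by simp
  qed
  have Zn: "norm (Z x) \<le> 4 * M ^ 3 * c" if x: "norm x \<le> c" for x c
  proof -
    have "norm (Z x) \<le> norm (J (J (C x))) + norm (2 *\<^sub>R J (C (J x))) + norm (C (J (J x)))"
      unfolding Z by (intro order_trans[OF norm_triangle_ineq] add_right_mono norm_triangle_ineq4)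
    also have "\<dots> \<le> M * (M * (M * c)) + 2 * (M * (M * (M * c))) + M * (M * (M * c))"
      using JM'[OF CM'[OF JM'[OF x]]] by (intro add_mono JM' CM' x) simp
    finally show ?thesis by (simp add: power3_eq_cube mult_ac)
  qed
  have bZ: "bounded_clinear Z"
    unfolding Z by (intro bounded_clinear_intros comp[OF bJ comp[OF bJ bC]] comp[OF bJ comp[OF bC bJ]]
        comp[OF bC comp[OF bJ bJ]])
  have "Z (J (J u)) = Z (P (R u)) + s\<^sup>2 *\<^sub>R Z u"
    by (simp add: RP(1)[symmetric] bounded_clinearD[OF bZ])
  moreover have "norm (Z (P (R u))) \<le> 4 * M ^ 3 * (2 * M * (d * norm u))"
    by (intro Zn PM' R1)
  then have "norm (Z (P (R u))) \<le> 8 * M ^ 4 * d * norm u"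
    by (simp add: power_numeral_reduce mult_ac)
  ultimately show ?thesis
    using norm_triangle_ineq[of "Z (P (R u))" "s\<^sup>2 *\<^sub>R Z u"] sZ by simp
qed

text \<open>
  If the double commutator vanishes, then so does the one formed with \<open>R = J - s\<close>, that is
  \<open>R\<^sup>2 C = 2 R C R - C R\<^sup>2\<close>. Pairing with \<open>C u\<close> gives a quadratic inequality for \<open>\<parallel>R C u\<parallel>\<close> with
  coefficients of size \<open>d\<close>, and the commutator equals \<open>R C - C R\<close>.
\<close>

lemma commutator_slice:
  fixes J C :: "'a::chilbert_space \<Rightarrow> 'a"
  assumes J: "sym_op J" and C: "sym_op C" and M: "M \<ge> 1"
    and CM: "\<And>x. norm (C x) \<le> M * norm x"
    and Z: "\<And>x. J (J (C x)) - 2 *\<^sub>R J (C (J x)) + C (J (J x)) = 0"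
    and d: "d > 0"
    and sl: "norm (J (J u - s *\<^sub>R u) - s *\<^sub>R (J u - s *\<^sub>R u)) \<le> d\<^sup>2 * norm u"
  shows "norm (J (C u) - C (J u)) \<le> 4 * M * d * norm u"
proof -
  note bJ = sym_opD(1)[OF J] and bC = sym_opD(1)[OF C]
  note Jl = bounded_clinearD[OF bJ] and Cl = bounded_clinearD[OF bC]
  note Js = sym_opD(2)[OF J] and Cs = sym_opD(2)[OF C]
  have M0: "M > 0" using M by simp
  define R where "R x = J x - s *\<^sub>R x" for x
  have Rs: "cinner (R x) y = cinner x (R y)" for x y
    by (simp add: R_def cinner_simps Js)
  have R2: "norm (R (R u)) \<le> d\<^sup>2 * norm u" using sl by (simp add: R_def)
  have R1: "norm (R u) \<le> d * norm u"
    using sym_op_shift_norm_le[OF J d sl] by (simp add: R_def)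
  have CM': "norm (C x) \<le> M * c" if "norm x \<le> c" for x c
    using CM[of x] that M0 by (meson mult_left_mono less_imp_le order_trans)
  have "R (R (C u)) - 2 *\<^sub>R R (C (R u)) + C (R (R u)) = J (J (C u)) - 2 *\<^sub>R J (C (J u)) + C (J (J u))"
    unfolding R_def scaleR_2 by (simp add: Jl Cl algebra_simps)
  then have RRC: "R (R (C u)) = 2 *\<^sub>R R (C (R u)) - C (R (R u))"
  proof -
    assume "R (R (C u)) - 2 *\<^sub>R R (C (R u)) + C (R (R u)) = J (J (C u)) - 2 *\<^sub>R J (C (J u)) + C (J (J u))"
    then have "R (R (C u)) - 2 *\<^sub>R R (C (R u)) = - C (R (R u))"
      by (simp only: Z eq_neg_iff_add_eq_0)
    then show ?thesis by (simp add: algebra_simps)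
  qed
  define n where "n = norm (R (C u))"
  define m where "m = M * d * norm u"
  have m0: "m \<ge> 0" using M0 d by (simp add: m_def)
  have "n\<^sup>2 = Re (cinner (R (R (C u))) (C u))"
    by (simp add: n_def norm_sq_cinner Rs)
  also have "\<dots> = 2 * Re (cinner (C (R u)) (R (C u))) - Re (cinner (C (R (R u))) (C u))"
    by (simp add: RRC cinner_simps Rs)
  also have "\<dots> \<le> 2 * (norm (C (R u)) * n) + norm (C (R (R u))) * norm (C u)"
    using Cauchy_Schwarz_Re[of "C (R u)" "R (C u)"] Cauchy_Schwarz_abs_Re[of "C (R (R u))" "C u"]
    by (simp add: n_def)
  also have "\<dots> \<le> 2 * (M * (d * norm u) * n) + (M * (d\<^sup>2 * norm u)) * (M * norm u)"
    using M0 d by (intro add_mono mult_left_mono mult_mono CM' R1 R2) (auto simp: n_def)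
  also have "\<dots> = 2 * m * n + m\<^sup>2" by (simp add: m_def power2_eq_square mult_ac)
  finally have q: "n\<^sup>2 \<le> 2 * m * n + m\<^sup>2" .
  have n3: "n \<le> 3 * m"
  proof (rule ccontr)
    assume "\<not> n \<le> 3 * m"
    then have "(n - m)\<^sup>2 > (2 * m)\<^sup>2" using m0 by (intro power_strict_mono) auto
    moreover have "(n - m)\<^sup>2 \<le> 2 * m\<^sup>2" using q by (simp add: power2_diff algebra_simps)
    moreover have "m\<^sup>2 \<ge> 0" by simp
    ultimately show False by (simp add: power_mult_distrib)
  qed
  have "J (C u) - C (J u) = R (C u) - C (R u)"
    by (simp add: R_def Cl)
  then have "norm (J (C u) - C (J u)) \<le> n + norm (C (R u))"
    using norm_triangle_ineq4[of "R (C u)" "C (R u)"] by (simp add: n_def)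
  also have "\<dots> \<le> 3 * m + M * (d * norm u)"
    by (intro add_mono n3 CM' R1)
  finally show ?thesis by (simp add: m_def)
qed

text \<open>
  The hypothesis says that \<open>n \<mapsto> \<langle>C J\<^sup>n w, J\<^sup>n w\<rangle>\<close> is logarithmically convex for every \<open>w\<close>. The slice estimates show
  first that \<open>Z J\<^sup>2 = 0\<close> for the double commutator \<open>Z\<close>; by symmetry \<open>J\<^sup>2 Z = 0\<close>, and the condition on the
  kernels improves this to \<open>Z\<^sup>2 = 0\<close>, hence \<open>Z = 0\<close>. Then a second round of slicing removes the commutator itself.
\<close>

lemma commute_if_moments_log_convex:
  fixes J C :: "'a::chilbert_space \<Rightarrow> 'a"
  assumes J: "sym_op J" and C: "pos_op C"
    and pos: "\<And>w m. 0 \<le> m \<Longrightarrow>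
      0 \<le> Re (cinner (C (J (J w))) (J (J w))) - 2 * m * Re (cinner (C (J w)) (J w)) + m\<^sup>2 * Re (cinner (C w) w)"
    and ker: "\<And>w. J w = 0 \<Longrightarrow> C w = 0"
  shows "J (C x) = C (J x)"
proof -
  have sC: "sym_op C" using C by (simp add: pos_op_def)
  note bJ = sym_opD(1)[OF J] and bC = sym_opD(1)[OF sC]
  note Jl = bounded_clinearD[OF bJ] and Cl = bounded_clinearD[OF bC]
  note Js = sym_opD(2)[OF J] and Cs = sym_opD(2)[OF sC]
  note comp = bounded_clinear_compose
  obtain M where M: "M \<ge> 1" and JM: "\<And>x. norm (J x) \<le> M * norm x" and CM: "\<And>x. norm (C x) \<le> M * norm x"
    by (rule bounded_clinear_common_bound[OF bJ bC]) blast
  have M0: "M > 0" using M by simp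
  define Z where "Z x = J (J (C x)) - 2 *\<^sub>R J (C (J x)) + C (J (J x))" for x
  have bZ: "bounded_clinear Z"
    unfolding Z_def by (intro bounded_clinear_intros comp[OF bJ comp[OF bJ bC]] comp[OF bJ comp[OF bC bJ]]
        comp[OF bC comp[OF bJ bJ]])
  have Zs: "cinner (Z x) y = cinner x (Z y)" for x y
    by (simp add: Z_def cinner_simps Js Cs)
  have ZJJ: "Z (J (J x)) = 0" for x
  proof (rule zero_by_spectral_slices[OF J comp[OF bZ comp[OF bJ bJ]] M0 JM, of "21 * M ^ 4"])
    fix s d u assume "\<bar>s\<bar> \<le> M" "d > 0"
      "norm (J (J u - s *\<^sub>R u) - s *\<^sub>R (J u - s *\<^sub>R u)) \<le> d\<^sup>2 * norm u"
    from double_commutator_slice[OF J C M JM CM pos this Z_def]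
    show "norm (Z (J (J u))) \<le> 21 * M ^ 4 * d * norm u" .
  qed (use M0 in simp)
  have JJZ: "J (J (Z x)) = 0" for x
    by (rule cinner_eqI) (simp add: Js[symmetric] Zs[symmetric] ZJJ)
  have JZ: "J (Z x) = 0" for x
  proof -
    have "cinner (J (Z x)) (J (Z x)) = 0"
      by (simp add: Js JJZ)
    then show ?thesis by (simp add: cinner_self_eq)
  qed
  have Z0: "Z x = 0" for x
  proof -
    have "Z (Z x) = 0"
      unfolding Z_def[of "Z x"] by (simp add: JZ ker[OF JZ] Jl Cl)
    then have "cinner (Z x) (Z x) = 0" by (simp add: Zs)
    then show ?thesis by (simp add: cinner_self_eq)
  qed
  have "J (C x) - C (J x) = 0" for x
  proof (rule zero_by_spectral_slices[OF J bounded_clinear_diff[OF comp[OF bJ bC] comp[OF bC bJ]] M0 JM, of "4 * M"])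
    fix s d u assume "\<bar>s\<bar> \<le> M" "d > 0"
      "norm (J (J u - s *\<^sub>R u) - s *\<^sub>R (J u - s *\<^sub>R u)) \<le> d\<^sup>2 * norm u"
    then show "norm (J (C u) - C (J u)) \<le> 4 * M * d * norm u"
      using Z0 by (intro commutator_slice[OF J sC M CM]) (auto simp: Z_def)
  qed (use M0 in simp)
  then show ?thesis by simp
qed

section \<open>Powers of positive operators\<close>

lemma spec_in_pos_op:
  fixes A :: "'a::chilbert_space \<Rightarrow> 'a"
  assumes A: "pos_op A" and M: "\<And>x. norm (A x) \<le> M * norm x"
  shows "spec_in A {0..M}"
  unfolding spec_in_def
proof (intro conjI compact_Icc subsetI)
  show s: "sym_op A" using A by (simp add: pos_op_def)
  fix z assume z: "z \<in> spectrum A"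
  have "Im z = 0" by (rule spectrum_sym_op_real[OF s z])
  moreover have "0 \<le> Re z" by (rule spectrum_pos_op[OF A z])
  moreover have "Re z \<le> M"
    using spectrum_norm_le[OF s M z] abs_Re_le_cmod[of z] by linarith
  ultimately show "z \<in> complex_of_real ` {0..M}"
    by (intro image_eqI[of _ _ "Re z"]) (auto simp: complex_eq_iff)
qed

lemma pos_op_spec_inE:
  fixes A :: "'a::chilbert_space \<Rightarrow> 'a"
  assumes "pos_op A"
  obtains M where "M > 0" "spec_in A {0..M}"
  using bounded_clinear_bound[of A] spec_in_pos_op[OF assms] assms
  unfolding pos_op_def sym_op_def by metis

lemma op_powr_eq_cfc: "op_powr A s = cfc (\<lambda>t. t powr s) A"
  by (simp add: op_powr_def cfc_def)

lemma continuous_on_powr_nonneg: "s > 0 \<Longrightarrow> continuous_on {0..M::real} (\<lambda>t. t powr s)"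
  by (rule continuous_on_powr') (auto intro: continuous_intros)

lemma pos_op_op_powr:
  fixes A :: "'a::chilbert_space \<Rightarrow> 'a"
  assumes "pos_op A" "s > 0"
  shows "pos_op (op_powr A s)"
proof -
  obtain M where "spec_in A {0..M}" using pos_op_spec_inE[OF assms(1)] .
  then show ?thesis
    unfolding op_powr_eq_cfc by (rule cfc_nonneg) (use assms in \<open>auto intro: continuous_on_powr_nonneg\<close>)
qed

lemma op_powr_add:
  fixes A :: "'a::chilbert_space \<Rightarrow> 'a"
  assumes "pos_op A" "s > 0" "t > 0"
  shows "op_powr A s (op_powr A t x) = op_powr A (s + t) x"
proof -
  obtain M where A: "spec_in A {0..M}" using pos_op_spec_inE[OF assms(1)] .
  note c = continuous_on_powr_nonneg[OF assms(2), of M] continuous_on_powr_nonneg[OF assms(3), of M]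
  show ?thesis
    unfolding op_powr_eq_cfc by (simp add: powr_add cfc_mult[OF A c])
qed

lemma op_powr_one:
  fixes A :: "'a::chilbert_space \<Rightarrow> 'a"
  assumes "pos_op A"
  shows "op_powr A 1 x = A x"
proof -
  obtain M where A: "spec_in A {0..M}" using pos_op_spec_inE[OF assms(1)] .
  have "cfc (\<lambda>t. t powr 1) A = cfc (\<lambda>t. t) A"
    by (rule cfc_cong[OF A continuous_on_powr_nonneg]) auto
  then show ?thesis by (simp add: op_powr_eq_cfc cfc_id[OF A])
qed

text \<open>
  The graph of \<open>y \<mapsto> y\<^sup>k\<close> lies above its tangent at \<open>a\<close>, divided by \<open>a\<^sup>k\<close>.
\<close>

lemma powr_tangent:
  fixes y a k :: real
  assumes "y \<ge> 0" "a > 0" "k > 1"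
  shows "k * (y / a) \<le> y powr k / a powr k + (k - 1)"
proof (cases "y = 0")
  case False
  then have ya: "y / a > 0" using assms by simp
  have "((y / a) powr k) powr (1 / k) * 1 powr (1 - 1 / k) \<le> (1 / k) * (y / a) powr k + (1 - 1 / k) * 1"
    using assms ya by (intro Youngs_inequality_0) auto
  then have "y / a \<le> (1 / k) * (y / a) powr k + (1 - 1 / k)"
    using assms ya by (simp add: powr_powr)
  then have "k * (y / a) \<le> k * ((1 / k) * (y / a) powr k + (1 - 1 / k))"
    using assms by (intro mult_left_mono) auto
  also have "\<dots> = (y / a) powr k + (k - 1)" using assms by (simp add: field_simps)
  finally show ?thesis using assms by (simp add: powr_divide)
qed (use assms in simp)

text \<open>
  Jensen's inequality for \<open>y \<mapsto> y\<^sup>k\<close> with \<open>k = t / s\<close> and the spectral distribution of \<open>x\<close>: apply the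
  functional calculus to the tangent inequality at the mean \<open>a = \<parallel>A\<^sup>s x\<parallel>\<^sup>2\<close> of \<open>A\<^bsup>2s\<^esup>\<close> and pair with \<open>x\<close>.
\<close>

lemma op_powr_log_convex:
  fixes A :: "'a::chilbert_space \<Rightarrow> 'a"
  assumes A: "pos_op A" and s: "0 < s" "s < t" and x: "norm x = 1"
  shows "norm (op_powr A s x) powr t \<le> norm (op_powr A t x) powr s"
proof (cases "op_powr A s x = 0")
  case False
  obtain M where M: "M > 0" "spec_in A {0..M}" using pos_op_spec_inE[OF A] .
  have t: "t > 0" using s by simp
  note c = continuous_on_powr_nonneg[of _ M]
  define k where "k = t / s"
  have k: "k > 1" "s * k = t" using s by (auto simp: k_def)
  have sq: "(norm (op_powr A u x))\<^sup>2 = Re (cinner (cfc (\<lambda>\<tau>. \<tau> powr (2 * u)) A x) x)" if "u > 0" for u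
  proof -
    have "cfc (\<lambda>\<tau>. (\<tau> powr u)\<^sup>2) A = cfc (\<lambda>\<tau>. \<tau> powr (2 * u)) A"
      by (rule cfc_cong[OF M(2)])
        (use that in \<open>auto simp: power2_eq_square powr_add[symmetric] intro!: continuous_intros c\<close>)
    then show ?thesis
      by (simp add: op_powr_eq_cfc norm_cfc_sq[OF M(2) c[OF that]])
  qed
  define a where "a = (norm (op_powr A s x))\<^sup>2"
  define b where "b = (norm (op_powr A t x))\<^sup>2"
  have a: "a > 0" using False by (simp add: a_def)
  have "Re (cinner (cfc (\<lambda>\<tau>. (k / a) * \<tau> powr (2 * s)) A x) x)
      \<le> Re (cinner (cfc (\<lambda>\<tau>. (1 / a powr k) * \<tau> powr (2 * t) + (k - 1)) A x) x)"
  proof (rule cfc_mono[OF M(2)])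
    fix \<tau> assume "\<tau> \<in> {0..M}"
    then have "(\<tau> powr (2 * s)) powr k = \<tau> powr (2 * t)"
      using k by (simp add: powr_powr mult.assoc)
    then show "(k / a) * \<tau> powr (2 * s) \<le> (1 / a powr k) * \<tau> powr (2 * t) + (k - 1)"
      using powr_tangent[of "\<tau> powr (2 * s)" a k] a k by simp
  qed (use s t a in \<open>auto intro!: continuous_intros c\<close>)
  moreover have "cfc (\<lambda>\<tau>. (k / a) * \<tau> powr (2 * s)) A x = (k / a) *\<^sub>R cfc (\<lambda>\<tau>. \<tau> powr (2 * s)) A x"
    using s by (intro cfc_scale[OF M(2)] c) auto
  moreover have "cfc (\<lambda>\<tau>. (1 / a powr k) * \<tau> powr (2 * t) + (k - 1)) A x
      = (1 / a powr k) *\<^sub>R cfc (\<lambda>\<tau>. \<tau> powr (2 * t)) A x + (k - 1) *\<^sub>R x"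
    using t c[of "2 * t"]
    by (simp add: cfc_add[OF M(2) continuous_on_mult[OF continuous_on_const c[of "2 * t"]] continuous_on_const]
        cfc_const[OF M(2)] cfc_scale[OF M(2) c[of "2 * t"]] del: times_divide_eq_left)
  ultimately have "(k / a) * a \<le> (1 / a powr k) * b + (k - 1)"
    using s t x by (simp add: a_def b_def sq cinner_simps cinner_self_eq)
  then have "1 \<le> b / a powr k" using a by simp
  then have ab: "a powr k \<le> b" using a by (simp add: pos_le_divide_eq)
  have "(a powr k) powr (s / 2) \<le> b powr (s / 2)"
    using ab s by (intro powr_mono2) auto
  moreover have "(a powr k) powr (s / 2) = norm (op_powr A s x) powr t"
    using False k by (simp add: a_def powr_powr mult.commute flip: powr_numeral)
  moreover have "b powr (s / 2) = norm (op_powr A t x) powr s"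
  proof (cases "op_powr A t x = 0")
    case True then show ?thesis by (simp add: b_def)
  next
    case False then show ?thesis by (simp add: b_def powr_powr flip: powr_numeral)
  qed
  ultimately show ?thesis by simp
qed simp

lemma op_powr_scaleR:
  fixes A :: "'a::chilbert_space \<Rightarrow> 'a"
  assumes "pos_op A" "s > 0"
  shows "op_powr A s (c *\<^sub>R x) = c *\<^sub>R op_powr A s x"
  using pos_op_op_powr[OF assms] by (simp add: pos_op_def sym_op_def bounded_clinearD)

text \<open>
  The homogeneous version, in logarithms so that several instances can be combined linearly.
\<close>

lemma op_powr_ln_convex:
  fixes A :: "'a::chilbert_space \<Rightarrow> 'a"
  assumes A: "pos_op A" and s: "0 < s" "s < t" and nz: "op_powr A s x \<noteq> 0"
  shows "op_powr A t x \<noteq> 0"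
    and "t * ln (norm (op_powr A s x)) \<le> s * ln (norm (op_powr A t x)) + (t - s) * ln (norm x)"
proof -
  have t: "t > 0" using s by simp
  have x0: "x \<noteq> 0"
    using nz pos_op_op_powr[OF A s(1)] by (auto simp: pos_op_def sym_op_def bounded_clinearD)
  have ineq: "(norm (op_powr A s x) / norm x) powr t \<le> (norm (op_powr A t x) / norm x) powr s"
    using op_powr_log_convex[OF A s, of "(1 / norm x) *\<^sub>R x"] x0
    by (simp add: op_powr_scaleR[OF A s(1)] op_powr_scaleR[OF A t])
  have p: "(norm (op_powr A s x) / norm x) powr t > 0" using nz x0 by simp
  show nz': "op_powr A t x \<noteq> 0"
    using ineq p s by auto
  have "ln ((norm (op_powr A s x) / norm x) powr t) \<le> ln ((norm (op_powr A t x) / norm x) powr s)"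
    using ineq p by (intro iffD2[OF ln_le_cancel_iff]) linarith+
  then have "t * (ln (norm (op_powr A s x)) - ln (norm x)) \<le> s * (ln (norm (op_powr A t x)) - ln (norm x))"
    using nz nz' x0 by (simp add: ln_powr ln_div)
  then show "t * ln (norm (op_powr A s x)) \<le> s * ln (norm (op_powr A t x)) + (t - s) * ln (norm x)"
    by (simp add: algebra_simps)
qed

text \<open>
  Raising the exponent enlarges the kernel because \<open>A\<^sup>t = A\<^bsup>t - s\<^esup> A\<^sup>s\<close> for \<open>s < t\<close>; lowering it does so by logarithmic convexity.
\<close>

lemma op_powr_kernel_le:
  fixes A :: "'a::chilbert_space \<Rightarrow> 'a"
  assumes A: "pos_op A" and s: "0 < s" "0 < t" and z: "op_powr A s x = 0"
  shows "op_powr A t x = 0"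
proof (rule ccontr)
  assume nz: "op_powr A t x \<noteq> 0"
  consider "s = t" | "t < s" | "s < t" by linarith
  then show False
  proof cases
    case 2
    then show False using op_powr_ln_convex(1)[OF A s(2) _ nz, of s] z by simp
  next
    case 3
    then have "op_powr A t x = op_powr A (t - s) (op_powr A s x)"
      using op_powr_add[OF A, of "t - s" s x] s by simp
    also have "\<dots> = 0"
      using pos_op_op_powr[OF A, of "t - s"] 3 z by (simp add: pos_op_def sym_op_def bounded_clinearD)
    finally show False using nz by simp
  qed (use z nz in simp)
qed

lemma op_powr_eq_0_iff:
  fixes A :: "'a::chilbert_space \<Rightarrow> 'a"
  assumes A: "pos_op A" and s: "0 < s"
  shows "op_powr A s x = 0 \<longleftrightarrow> A x = 0"
  using op_powr_kernel_le[OF A s, of 1 x] op_powr_kernel_le[OF A _ s, of 1 x] op_powr_one[OF A, of x]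
  by auto

lemma rpoly_op_cfc:
  fixes A :: "'a::chilbert_space \<Rightarrow> 'a"
  assumes A: "spec_in A I" and g: "continuous_on I g"
  shows "rpoly_op q (cfc g A) x = cfc (\<lambda>t. poly q (g t)) A x"
proof (induction q)
  case 0
  then show ?case using cfc_const[OF A, of 0 x] by simp
next
  case (pCons c q)
  have c: "continuous_on I (\<lambda>t. poly q (g t))" by (intro continuous_intros g)
  show ?case
    using cfc_add[OF A continuous_on_const continuous_on_mult[OF g c], of c x] pCons.IH
    by (simp add: rpoly_op_pCons[OF bounded_clinear_cfc[OF A g]] cfc_const[OF A] cfc_mult[OF A g c])
qed

lemma cfc_compose:
  fixes A :: "'a::chilbert_space \<Rightarrow> 'a"
  assumes A: "spec_in A I" and g: "continuous_on I g"
    and B: "spec_in (cfc g A) I'" and sub: "g ` I \<subseteq> I'" and h: "continuous_on I' h"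
  shows "cfc h (cfc g A) x = cfc (\<lambda>t. h (g t)) A x"
proof -
  obtain p where p: "uniform_limit I' (\<lambda>n. poly (p n)) h sequentially"
    using cfc_polys[OF spec_inD(3)[OF B] h] .
  have hg: "continuous_on I (\<lambda>t. h (g t))"
    by (rule continuous_on_compose2[OF h g sub])
  show ?thesis
  proof (rule cfc_eq_limit[OF B h p], rule LIMSEQ_I)
    fix e :: real assume e: "e > 0"
    define d where "d = e / (norm x + 1)"
    have "norm x + 1 > 0" by (simp add: add_nonneg_pos)
    then have d: "d > 0" "d * norm x < e" using e by (simp_all add: d_def field_simps)
    have "\<forall>\<^sub>F n in sequentially. \<forall>t\<in>I'. dist (poly (p n) t) (h t) < d"
      using p d by (auto simp: uniform_limit_iff)
    then obtain N where N: "\<And>n t. n \<ge> N \<Longrightarrow> t \<in> I' \<Longrightarrow> \<bar>poly (p n) t - h t\<bar> < d"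
      by (auto simp: eventually_sequentially dist_real_def)
    have "norm (rpoly_op (p n) (cfc g A) x - cfc (\<lambda>t. h (g t)) A x) < e" if n: "n \<ge> N" for n
    proof -
      have c: "continuous_on I (\<lambda>t. poly (p n) (g t))" by (intro continuous_intros g)
      have "norm (rpoly_op (p n) (cfc g A) x - cfc (\<lambda>t. h (g t)) A x)
          = norm (cfc (\<lambda>t. poly (p n) (g t) - h (g t)) A x)"
        by (simp add: rpoly_op_cfc[OF A g] cfc_diff[OF A c hg])
      also have "\<dots> \<le> norm (cfc (\<lambda>t. d) A x)"
        by (rule norm_cfc_mono[OF A continuous_on_diff[OF c hg] continuous_on_const])
          (use N[OF n] sub d in \<open>force intro: less_imp_le\<close>)
      also have "\<dots> < e" using d by (simp add: cfc_const[OF A])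
      finally show ?thesis .
    qed
    then show "\<exists>N. \<forall>n\<ge>N. norm (rpoly_op (p n) (cfc g A) x - cfc (\<lambda>t. h (g t)) A x) < e" by blast
  qed
qed

text \<open>
  Here \<open>A\<close> is recovered from \<open>A\<^sup>m\<close> as a limit of polynomials of \<open>A\<^sup>m\<close>.
\<close>

lemma commute_with_root:
  fixes A D :: "'a::chilbert_space \<Rightarrow> 'a"
  assumes A: "pos_op A" and m: "m > 0" and D: "bounded_clinear D"
    and c: "\<And>x. D (op_powr A m x) = op_powr A m (D x)"
  shows "D (A x) = A (D x)"
proof -
  obtain M where M: "M > 0" "spec_in A {0..M}" using pos_op_spec_inE[OF A] .
  let ?C = "op_powr A m"
  have C: "pos_op ?C" by (rule pos_op_op_powr[OF A m])
  then obtain K where K: "K > 0" "\<And>x. norm (?C x) \<le> K * norm x"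
    using bounded_clinear_bound[of ?C] unfolding pos_op_def sym_op_def by metis
  define L where "L = max K (M powr m)"
  have "K * norm x \<le> L * norm x" for x :: 'a by (rule mult_right_mono) (auto simp: L_def)
  then have "norm (?C x) \<le> L * norm x" for x by (rule order_trans[OF K(2)])
  then have sC: "spec_in ?C {0..L}" by (rule spec_in_pos_op[OF C])
  have m': "1 / m > 0" using m by simp
  note cm = continuous_on_powr_nonneg[OF m, of M] and cr = continuous_on_powr_nonneg[OF m', of L]
  have sub: "(\<lambda>t. t powr m) ` {0..M} \<subseteq> {0..L}"
  proof (rule image_subsetI)
    fix t assume "t \<in> {0..M}"
    then have "t powr m \<le> M powr m" using m by (intro powr_mono2) auto
    then show "t powr m \<in> {0..L}" by (simp add: L_def)
  qed
  have root: "cfc (\<lambda>t. t powr (1 / m)) ?C x = A x" for x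
  proof -
    have "cfc (\<lambda>t. t powr (1 / m)) ?C x = cfc (\<lambda>t. (t powr m) powr (1 / m)) A x"
      using cfc_compose[OF M(2) cm _ sub cr, of x] sC by (simp add: op_powr_eq_cfc)
    also have "cfc (\<lambda>t. (t powr m) powr (1 / m)) A = cfc (\<lambda>t. t) A"
      by (rule cfc_cong[OF M(2) continuous_on_compose2[OF cr cm sub]]) (use m in \<open>simp add: powr_powr\<close>)
    finally show ?thesis by (simp add: cfc_id[OF M(2)])
  qed
  show ?thesis
    using cfc_commute[OF sC cr D c, of x] by (simp add: root)
qed

lemma pos_op_conj:
  fixes Q U :: "'a::chilbert_space \<Rightarrow> 'a"
  assumes Q: "pos_op Q" and U: "sym_op U"
  shows "pos_op (\<lambda>x. U (Q (U x)))"
proof -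
  have sQ: "sym_op Q" using Q by (simp add: pos_op_def)
  note bU = sym_opD(1)[OF U] and bQ = sym_opD(1)[OF sQ]
  show ?thesis
    unfolding pos_op_def sym_op_def
  proof (intro conjI allI)
    show "bounded_clinear (\<lambda>x. U (Q (U x)))"
      by (rule bounded_clinear_compose[OF bU bounded_clinear_compose[OF bQ bU]])
    show "cinner (U (Q (U x))) y = cinner x (U (Q (U y)))" for x y
      by (simp add: sym_opD(2)[OF U] sym_opD(2)[OF sQ])
    have "cinner (U (Q (U x))) x = cinner (Q (U x)) (U x)" for x
      by (rule sym_opD(2)[OF U])
    then show "0 \<le> Re (cinner (U (Q (U x))) x)" for x
      using Q by (simp add: pos_op_def)
  qed
qed

section \<open>Conjugation by a partial symmetry\<close>

text \<open>
  If \<open>Q U\<^sup>2 = Q\<close>, then \<open>(U Q U)\<^sup>k = U Q\<^sup>k U\<close> for \<open>k \<ge> 1\<close>. This fails for \<open>k = 0\<close>, whence the condition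
  \<open>f 0 = 0\<close>, which allows approximation by polynomials without constant term.
\<close>

lemma cfc_conj:
  fixes Q U :: "'a::chilbert_space \<Rightarrow> 'a"
  assumes Q: "pos_op Q" and U: "sym_op U" and QUU: "\<And>x. Q (U (U x)) = Q x"
    and f: "\<And>M. continuous_on {0..M} f" and f0: "f 0 = 0"
  shows "cfc f (\<lambda>x. U (Q (U x))) x = U (cfc f Q (U x))"
proof -
  let ?W = "\<lambda>x. U (Q (U x))"
  have W: "pos_op ?W" by (rule pos_op_conj[OF Q U])
  have bU: "bounded_clinear U" and bQ: "bounded_clinear Q" and bW: "bounded_clinear ?W"
    using U Q W by (auto simp: pos_op_def sym_op_def)
  note Ul = bounded_clinearD[OF bU] and Ql = bounded_clinearD[OF bQ]
  obtain M where M: "M \<ge> 1" "\<And>x. norm (Q x) \<le> M * norm x" "\<And>x. norm (?W x) \<le> M * norm x"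
    by (rule bounded_clinear_common_bound[OF bQ bW]) blast
  have sQ: "spec_in Q {0..M}" by (rule spec_in_pos_op[OF Q M(2)])
  have sW: "spec_in ?W {0..M}" by (rule spec_in_pos_op[OF W M(3)])
  obtain p where p: "uniform_limit {0..M} (\<lambda>n. poly (p n)) f sequentially"
    using cfc_polys[OF compact_Icc f] .
  have "(\<lambda>n. poly (p n) 0) \<longlonglongrightarrow> 0"
    using tendsto_uniform_limitI[OF p, of 0] M(1) f0 by simp
  then have u0: "uniform_limit {0..M} (\<lambda>n t. poly (p n) 0) (\<lambda>t. 0) sequentially"
    by (auto simp: uniform_limit_iff tendsto_iff)
  define r where "r n = synthetic_div (p n) 0" for n
  have pr: "p n = pCons 0 (r n) + [:poly (p n) 0:]" for n
    using synthetic_div_correct'[of 0 "p n"] by (simp add: r_def)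
  have eqf: "poly (pCons 0 (r n)) = (\<lambda>t. poly (p n) t - poly (p n) 0)" for n
  proof
    fix t
    have h: "poly (p n) t = poly (pCons 0 (r n) + [:poly (p n) 0:]) t"
      by (rule arg_cong[OF pr])
    show "poly (pCons 0 (r n)) t = poly (p n) t - poly (p n) 0"
      by (subst h) simp
  qed
  then have q: "uniform_limit {0..M} (\<lambda>n. poly (pCons 0 (r n))) f sequentially"
    using uniform_limit_minus[OF p u0] by (simp only: eqf diff_0_right)
  have QU: "Q (U (rpoly_op q ?W x)) = Q (rpoly_op q Q (U x))" for q x
    by (induction q) (simp_all add: rpoly_op_pCons[OF bW] rpoly_op_pCons[OF bQ] Ul Ql QUU)
  have W': "rpoly_op (pCons 0 (r n)) ?W x = U (rpoly_op (pCons 0 (r n)) Q (U x))" for n x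
    by (simp add: rpoly_op_pCons[OF bW] rpoly_op_pCons[OF bQ] QU)
  have "bounded_linear U" using bU by (simp add: bounded_clinear_def)
  then have "(\<lambda>n. U (rpoly_op (pCons 0 (r n)) Q (U x))) \<longlonglongrightarrow> U (cfc f Q (U x))"
    by (intro bounded_linear.tendsto[of U] cfc_tendsto[OF sQ f q] tendsto_const)
  then show ?thesis
    by (intro cfc_eq_limit[OF sW f q]) (simp add: W')
qed

lemma op_powr_conj:
  fixes Q U :: "'a::chilbert_space \<Rightarrow> 'a"
  assumes Q: "pos_op Q" and U: "sym_op U" and QUU: "\<And>x. Q (U (U x)) = Q x" and s: "s > 0"
  shows "op_powr (\<lambda>x. U (Q (U x))) s x = U (op_powr Q s (U x))"
  unfolding op_powr_eq_cfc
  by (rule cfc_conj[where f = "\<lambda>t. t powr s", OF Q U QUU continuous_on_powr_nonneg[OF s]]) simp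

section \<open>The modulus and the polar decomposition\<close>

lemma pos_op_cadjoint_comp:
  fixes T :: "'a::chilbert_space \<Rightarrow> 'a"
  assumes T: "bounded_clinear T"
  shows "pos_op (cadjoint T \<circ> T)"
  unfolding pos_op_def sym_op_def
proof (intro conjI allI)
  show "bounded_clinear (cadjoint T \<circ> T)"
    using bounded_clinear_compose[OF bounded_clinear_cadjoint[OF T] T] by (simp add: comp_def)
  show "cinner ((cadjoint T \<circ> T) x) y = cinner x ((cadjoint T \<circ> T) y)" for x y
    by (simp add: cinner_cadjoint'[OF T] cinner_cadjoint[OF T, symmetric])
  show "0 \<le> Re (cinner ((cadjoint T \<circ> T) x) x)" for x
    by (simp add: cinner_cadjoint'[OF T] cinner_self_eq)
qed

lemma op_abs_props:
  fixes T :: "'a::chilbert_space \<Rightarrow> 'a"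
  assumes T: "bounded_clinear T"
  shows pos_op_op_abs: "pos_op (op_abs T)"
    and op_abs_op_abs: "op_abs T (op_abs T x) = cadjoint T (T x)"
proof -
  note Q = pos_op_cadjoint_comp[OF T]
  show "pos_op (op_abs T)"
    unfolding op_abs_def by (rule pos_op_op_powr[OF Q]) simp
  show "op_abs T (op_abs T x) = cadjoint T (T x)"
    unfolding op_abs_def using op_powr_add[OF Q, of "1/2" "1/2" x] op_powr_one[OF Q, of x] by simp
qed

text \<open>
  The complementary projection \<open>1 - U* U\<close> is annihilated by \<open>U* U\<close>, hence by \<open>U\<close>.
\<close>

lemma partial_isometryD:
  fixes U :: "'a::chilbert_space \<Rightarrow> 'a"
  assumes "partial_isometry U"
  shows partial_isometry_bounded_clinear: "bounded_clinear U"
    and partial_isometry_triple: "U (cadjoint U (U x)) = U x"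
proof -
  show bU: "bounded_clinear U" using assms by (simp add: partial_isometry_def)
  note Ul = bounded_clinearD[OF bU]
  have idem: "cadjoint U (U (cadjoint U (U x))) = cadjoint U (U x)" for x
    using assms by (auto simp: partial_isometry_def orthogonal_projection_def fun_eq_iff)
  define w where "w = x - cadjoint U (U x)"
  have "cadjoint U (U w) = 0"
    by (simp add: w_def Ul bounded_clinearD[OF bounded_clinear_cadjoint[OF bU]] idem)
  then have "cinner (U w) (U w) = 0"
    by (simp add: cinner_cadjoint[OF bU])
  then have "U w = 0" by (simp add: cinner_self_eq)
  then show "U (cadjoint U (U x)) = U x" by (simp add: w_def Ul)
qed

lemma polar_decompositionD:
  fixes T U :: "'a::chilbert_space \<Rightarrow> 'a"
  assumes "polar_decomposition T U"
  shows "T x = U (op_abs T x)" "partial_isometry U" "U x = 0 \<longleftrightarrow> op_abs T x = 0"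
  using assms by (auto simp: polar_decomposition_def null_space_def fun_eq_iff set_eq_iff)

section \<open>Self-adjoint operators are paranormal with self-adjoint polar factor\<close>

text \<open>
  With \<open>V = U*\<close> one has \<open>T = U A = A V\<close>. Because \<open>T\<close> commutes with \<open>A\<close>, the commutator \<open>W = U A - A U\<close>
  satisfies \<open>W A = 0\<close>; as \<open>W\<close> also vanishes on the kernel of \<open>A\<close>, it is zero. Then \<open>A (U - V) = 0\<close>, so
  \<open>U\<^sup>2 = U V\<close>, and the remaining steps are algebra with \<open>U V U = U\<close>.
\<close>

lemma self_adjoint_imp_polar_factor_self_adjoint:
  fixes T U :: "'a::chilbert_space \<Rightarrow> 'a"
  assumes T: "bounded_clinear T" and pd: "polar_decomposition T U" and sa: "self_adjoint T"
  shows "self_adjoint U"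
proof -
  note TU = polar_decompositionD(1)[OF pd] and ker = polar_decompositionD(3)[OF pd]
  note pU = polar_decompositionD(2)[OF pd]
  note bU = partial_isometryD(1)[OF pU] and triple = partial_isometryD(2)[OF pU]
  define A where "A = op_abs T"
  define V where "V = cadjoint U"
  have A: "pos_op A" unfolding A_def by (rule pos_op_op_abs[OF T])
  have bA: "bounded_clinear A" and As: "\<And>x y. cinner (A x) y = cinner x (A y)"
    using A by (auto simp: pos_op_def sym_op_def)
  have bV: "bounded_clinear V" unfolding V_def by (rule bounded_clinear_cadjoint[OF bU])
  note Ul = bounded_clinearD[OF bU] and Vl = bounded_clinearD[OF bV] and Al = bounded_clinearD[OF bA]
  have UV: "cinner (U x) y = cinner x (V y)" for x y
    unfolding V_def by (rule cinner_cadjoint[OF bU])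
  have VU: "cinner (V x) y = cinner x (U y)" for x y
    unfolding V_def by (rule cinner_cadjoint'[OF bU])
  have UVU: "U (V (U x)) = U x" for x using triple by (simp add: V_def)
  have VUV: "V (U (V x)) = V x" for x
    by (rule cinner_eqI) (simp add: UV[symmetric] VU[symmetric] UVU)
  have T_eq: "T x = U (A x)" for x using TU by (simp add: A_def)
  have ker': "U x = 0 \<longleftrightarrow> A x = 0" for x using ker by (simp add: A_def)
  have adjT: "cadjoint T = T" using sa by (simp add: self_adjoint_def)
  have Ts: "cinner (T x) y = cinner x (T y)" for x y
    using cinner_cadjoint[OF T, of x y] adjT by simp
  have T_eq': "T x = A (V x)" for x
  proof (rule cinner_eqI)
    fix z
    have "cinner z (T x) = cinner (T z) x" by (simp only: Ts)
    also have "\<dots> = cinner z (A (V x))" by (simp only: T_eq UV As)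
    finally show "cinner z (T x) = cinner z (A (V x))" .
  qed
  obtain M where Q: "spec_in (cadjoint T \<circ> T) {0..M}"
    using pos_op_spec_inE[OF pos_op_cadjoint_comp[OF T]] .
  have TA: "T (A x) = A (T x)" for x
    unfolding A_def op_abs_def op_powr_eq_cfc
    by (rule cfc_commute[OF Q _ T]) (auto simp: adjT intro: continuous_on_powr_nonneg)
  have AP: "A (V (U x)) = A x" for x
  proof -
    have "U (x - V (U x)) = 0" by (simp add: Ul UVU)
    then show ?thesis by (simp add: ker' Al)
  qed
  have PA: "V (U (A x)) = A x" for x
    by (rule cinner_eqI) (simp add: As[symmetric] VU[symmetric] UV[symmetric] AP)
  define W where "W x = U (A x) - A (U x)" for x
  define W' where "W' x = A (V x) - V (A x)" for x
  have WA: "W (A x) = 0" for x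
    using TA[of x] by (simp add: W_def T_eq)
  \<comment> \<open>The adjoint \<open>W'\<close> maps into the kernel of \<open>A\<close>, where \<open>W\<close> vanishes; so \<open>W W' = 0\<close>.\<close>
  have WW': "cinner (W x) y = cinner x (W' y)" for x y
    by (simp add: W_def W'_def cinner_simps UV As)
  have AW': "A (W' x) = 0" for x
    by (rule cinner_eqI) (simp add: As[symmetric] WW'[symmetric] WA)
  have W'0: "W' x = 0" for x
  proof -
    have "W (W' x) = 0"
      using AW'[of x] ker'[of "W' x"] by (simp add: W_def Ul Al)
    then have "cinner (W' x) (W' x) = 0"
      using WW'[of "W' x" x] by simp
    then show ?thesis by (simp add: cinner_self_eq)
  qed
  have UA: "U (A x) = A (U x)" for x
  proof -
    have "cinner z (U (A x)) = cinner z (A (U x))" for z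
      using W'0[of z] by (simp add: VU[symmetric] As[symmetric] W'_def)
    then show ?thesis by (rule cinner_eqI)
  qed
  have AUV: "A (U x) = A (V x)" for x
    using T_eq[of x] T_eq'[of x] UA[of x] by simp
  have UUV: "U (U x) = U (V x)" for x
  proof -
    have "A (U x - V x) = 0" using AUV by (simp add: Al)
    then have "U (U x - V x) = 0" by (simp add: ker')
    then show ?thesis by (simp add: Ul)
  qed
  have PU: "V (U (U x)) = V x" for x
    by (simp add: UUV VUV)
  have VP: "V (V (U x)) = U x" for x
    by (rule cinner_eqI) (simp add: UV[symmetric] VU[symmetric] PU)
  have VP': "V (V (U x)) = V x" for x
  proof -
    have "V (V (U x)) = V (U (U (V (U x))))" by (simp add: PU)
    also have "\<dots> = V (U (U x))" by (simp add: UVU)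
    finally show ?thesis by (simp add: PU)
  qed
  have "V = U" using VP VP' by auto
  then show ?thesis by (simp add: self_adjoint_def V_def)
qed

lemma self_adjoint_imp_absolute_paranormal:
  fixes T :: "'a::chilbert_space \<Rightarrow> 'a"
  assumes T: "bounded_clinear T" and sa: "self_adjoint T" and pr: "p > 0" "r > 0"
  shows "absolute_paranormal p r T"
proof -
  have adjT: "cadjoint T = T" using sa by (simp add: self_adjoint_def)
  note A = pos_op_op_abs[OF T]
  show ?thesis
    unfolding absolute_paranormal_def adjT
    using op_powr_log_convex[OF A, of r "p + r"] pr by (simp add: op_powr_add[OF A])
qed

section \<open>Paranormal operators with self-adjoint polar factor are self-adjoint\<close>

text \<open>
  The paranormality inequality for arbitrary vectors, in logarithmic form.
\<close>

lemma absolute_paranormal_ln: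
  fixes T :: "'a::chilbert_space \<Rightarrow> 'a"
  assumes T: "bounded_clinear T" and pn: "absolute_paranormal p r T" and pr: "p > 0" "r > 0"
    and B: "\<And>x. op_powr (op_abs (cadjoint T)) r x = B x" "bounded_clinear B" and nz: "B x \<noteq> 0"
  shows "op_powr (op_abs T) p (B x) \<noteq> 0"
    and "(p + r) * ln (norm (B x)) \<le> r * ln (norm (op_powr (op_abs T) p (B x))) + p * ln (norm x)"
proof -
  note A = pos_op_op_abs[OF T]
  have x0: "x \<noteq> 0" using nz by (auto simp: bounded_clinearD[OF B(2)])
  let ?n = "norm (op_powr (op_abs T) p (B x))"
  have ineq: "(norm (B x) / norm x) powr (p + r) \<le> (?n / norm x) powr r"
    using pn[unfolded absolute_paranormal_def, rule_format, of "(1 / norm x) *\<^sub>R x"] x0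
    by (simp add: B(1) bounded_clinearD[OF B(2)] op_powr_scaleR[OF A pr(1)])
  have pos: "(norm (B x) / norm x) powr (p + r) > 0" using nz x0 by simp
  show nz': "op_powr (op_abs T) p (B x) \<noteq> 0"
    using ineq pos pr by auto
  have "ln ((norm (B x) / norm x) powr (p + r)) \<le> ln ((?n / norm x) powr r)"
    using ineq pos by (intro iffD2[OF ln_le_cancel_iff]) linarith+
  then have "(p + r) * (ln (norm (B x)) - ln (norm x)) \<le> r * (ln ?n - ln (norm x))"
    using nz nz' x0 by (simp add: ln_powr ln_div)
  then show "(p + r) * ln (norm (B x)) \<le> r * ln ?n + p * ln (norm x)"
    by (simp add: algebra_simps)
qed

text \<open>
  The hypothesis \<open>par\<close> is paranormality of \<open>U C\<close>. For \<open>J = D U D\<close> and \<open>y = U D w\<close> the norms of \<open>y\<close>, \<open>C y\<close> and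
  \<open>C U C y\<close> are those of \<open>D w\<close>, \<open>D J w\<close> and \<open>D J\<^sup>2 w\<close>, so it is logarithmic convexity of
  the moments \<open>\<langle>C J\<^sup>n w, J\<^sup>n w\<rangle>\<close>. From \<open>J C = C J\<close> one gets \<open>D V D = 0\<close> for the commutator \<open>V = U C - C U\<close>, and both factors
  can be cancelled since \<open>V\<close> lives on the orthogonal complement of the common kernel of \<open>U\<close>, \<open>C\<close> and \<open>D\<close>.
\<close>

lemma commute_if_paranormal_symmetry:
  fixes C D U :: "'a::chilbert_space \<Rightarrow> 'a"
  assumes D: "pos_op D" and C: "\<And>x. C x = D (D x)" and U: "sym_op U"
    and ker: "\<And>x. U x = 0 \<longleftrightarrow> C x = 0" and UUU: "\<And>x. U (U (U x)) = U x"
    and par: "\<And>y. (norm (C y))\<^sup>2 \<le> norm (C (U (C y))) * norm y"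
  shows "U (C x) = C (U x)"
proof -
  have bU: "bounded_clinear U" and Us: "\<And>x y. cinner (U x) y = cinner x (U y)"
    using U by (auto simp: sym_op_def)
  have bD: "bounded_clinear D" and Ds: "\<And>x y. cinner (D x) y = cinner x (D y)"
    and nnD: "\<And>x. 0 \<le> Re (cinner (D x) x)"
    using D by (auto simp: pos_op_def sym_op_def)
  note Ul = bounded_clinearD[OF bU] and Dl = bounded_clinearD[OF bD]
  note comp = bounded_clinear_compose
  have kerD: "D x = 0 \<longleftrightarrow> U x = 0" for x
  proof
    assume "U x = 0"
    then have "cinner (D (D x)) x = 0" using ker[of x] C[of x] by simp
    then have "cinner (D x) (D x) = 0" by (simp add: Ds)
    then show "D x = 0" by (simp add: cinner_self_eq)
  qed (simp add: ker C Dl)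
  have DUU: "D (U (U x)) = D x" for x
  proof -
    have "U (x - U (U x)) = 0" by (simp add: Ul UUU)
    then have "D (x - U (U x)) = 0" by (simp add: kerD)
    then show ?thesis by (simp add: Dl)
  qed
  have UUD: "U (U (D x)) = D x" for x
    by (rule cinner_eqI) (simp add: Us[symmetric] Ds[symmetric] DUU)
  have Uiso: "cinner (U (D x)) (U (D y)) = cinner (D x) (D y)" for x y
    by (simp add: Us UUD)
  define J where "J x = D (U (D x))" for x
  have J: "sym_op J"
    unfolding sym_op_def
  proof (intro conjI allI)
    show "bounded_clinear J" unfolding J_def by (rule comp[OF bD comp[OF bU bD]])
  qed (simp add: J_def Ds Us)
  have posC: "pos_op C"
    unfolding pos_op_def sym_op_def
  proof (intro conjI allI)
    show "bounded_clinear C" unfolding C by (rule comp[OF bD bD])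
    show "cinner (C x) y = cinner x (C y)" for x y by (simp add: C Ds)
    show "0 \<le> Re (cinner (C x) x)" for x using cinner_self_eq[of "D x"] by (simp add: C Ds)
  qed
  have JC: "J (C x) = C (J x)" for x
  proof (rule commute_if_moments_log_convex[OF J posC])
    fix w and m :: real assume m: "0 \<le> m"
    define y where "y = U (D w)"
    have n0: "Re (cinner (C w) w) = (norm y)\<^sup>2"
      by (simp add: y_def norm_sq_cinner Uiso C Ds[of "D w"])
    have "C y = D (J w)" by (simp add: y_def J_def C)
    then have n1: "Re (cinner (C (J w)) (J w)) = (norm (C y))\<^sup>2"
      by (simp add: norm_sq_cinner C[of "J w"] Ds[of "D (J w)"])
    have "C (U (C y)) = D (J (J w))" by (simp add: y_def J_def C)
    then have n2: "Re (cinner (C (J (J w))) (J (J w))) = (norm (C (U (C y))))\<^sup>2"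
      by (simp add: norm_sq_cinner C[of "J (J w)"] Ds[of "D (J (J w))"])
    have "m * (norm (C y))\<^sup>2 \<le> m * (norm (C (U (C y))) * norm y)"
      by (rule mult_left_mono[OF par m])
    moreover have "0 \<le> (norm (C (U (C y))) - m * norm y)\<^sup>2" by simp
    ultimately show "0 \<le> Re (cinner (C (J (J w))) (J (J w))) - 2 * m * Re (cinner (C (J w)) (J w))
        + m\<^sup>2 * Re (cinner (C w) w)"
      unfolding n0 n1 n2 by (simp add: power2_diff power_mult_distrib algebra_simps)
  next
    fix w assume "J w = 0"
    then have "U (U (D w)) = 0" by (simp add: J_def kerD)
    then show "C w = 0" by (simp add: UUD C Dl)
  qed
  define V where "V x = U (C x) - C (U x)" for x
  have Cs: "cinner (C x) y = cinner x (C y)" for x y by (simp add: C Ds)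
  have Cl: "C (x - y) = C x - C y" for x y by (simp add: C Dl)
  have Vs: "cinner (V x) y = - cinner x (V y)" for x y
    by (simp add: V_def cinner_simps Us Cs)
  have "D (V (D x)) = 0" for x
    using JC[of x] by (simp add: V_def J_def C Dl)
  then have CVC: "C (V (C x)) = 0" for x by (simp add: C Dl)
  have UUC: "U (U (C x)) = C x" for x by (simp add: C UUD)
  have VC: "V (C x) = 0" for x
  proof -
    have "U (V (C x)) = 0" using CVC by (simp add: ker)
    then have "U (U (V (C x))) = 0" by (simp add: Ul)
    moreover have "U (U (V (C x))) = V (C x)" by (simp add: V_def Ul UUU UUC)
    ultimately show ?thesis by simp
  qed
  have CV: "C (V x) = 0" for x
  proof (rule cinner_eqI)
    fix z
    have "cinner z (C (V x)) = - cinner (V (C z)) x"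
      by (simp add: Vs Cs)
    then show "cinner z (C (V x)) = cinner z 0" by (simp add: VC)
  qed
  have "V x = 0"
  proof -
    have "U (V x) = 0" using CV by (simp add: ker)
    then have "U (U (V x)) = 0" by (simp add: Ul)
    moreover have "U (U (V x)) = V x" by (simp add: V_def Ul UUU UUC)
    ultimately show ?thesis by simp
  qed
  then show ?thesis by (simp add: V_def)
qed

text \<open>
  The exponent \<open>m = p + r\<close> and the vector \<open>x = U A\<^sup>p y\<close> are chosen so that \<open>|T*|\<^sup>r x = U A\<^sup>m y\<close>.
  Let \<open>b = ln \<parallel>A\<^sup>m y\<parallel>\<close>. Paranormality bounds \<open>m b\<close> by a combination of the logarithms of \<open>\<parallel>A\<^sup>p U A\<^sup>m y\<parallel>\<close> and
  \<open>\<parallel>A\<^sup>p y\<parallel>\<close>, and logarithmic convexity between the exponents \<open>0\<close>, \<open>p\<close> and \<open>m\<close> replaces these by the logarithms for the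
  exponent \<open>m\<close> and for \<open>y\<close>. As \<open>m\<^sup>2 - p\<^sup>2 - r\<^sup>2 = 2 p r\<close>, the exponents \<open>p\<close> and \<open>r\<close> cancel.
\<close>

lemma absolute_paranormal_imp_self_adjoint:
  fixes T U :: "'a::chilbert_space \<Rightarrow> 'a"
  assumes T: "bounded_clinear T" and pd: "polar_decomposition T U" and pr: "p > 0" "r > 0"
    and pn: "absolute_paranormal p r T" and sU: "self_adjoint U"
  shows "self_adjoint T"
proof -
  note TU = polar_decompositionD(1)[OF pd] and ker0 = polar_decompositionD(3)[OF pd]
  note pU = polar_decompositionD(2)[OF pd]
  note bU = partial_isometryD(1)[OF pU]
  have U: "sym_op U" using sU self_adjoint_iff_sym_op[OF bU] by simp
  note Us = sym_opD(2)[OF U]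
  define A where "A = op_abs T"
  have A: "pos_op A" unfolding A_def by (rule pos_op_op_abs[OF T])
  have bA: "bounded_clinear A" and As: "\<And>x y. cinner (A x) y = cinner x (A y)"
    using A by (auto simp: pos_op_def sym_op_def)
  note Ul = bounded_clinearD[OF bU] and Al = bounded_clinearD[OF bA]
  have UUU: "U (U (U x)) = U x" for x
    using partial_isometryD(2)[OF pU, of x] sU by (simp add: self_adjoint_def)
  have ker: "U x = 0 \<longleftrightarrow> op_powr A s x = 0" if "s > 0" for s x
    using op_powr_eq_0_iff[OF A that] ker0 by (simp add: A_def)
  have AsUU: "op_powr A s (U (U x)) = op_powr A s x" if s: "s > 0" for s x
  proof -
    have "U (x - U (U x)) = 0" by (simp add: Ul UUU)
    then have "op_powr A s (x - U (U x)) = 0" by (simp add: ker[OF s])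
    then show ?thesis
      using pos_op_op_powr[OF A s] by (simp add: pos_op_def sym_op_def bounded_clinearD)
  qed
  have UUAs: "U (U (op_powr A s x)) = op_powr A s x" if s: "s > 0" for s x
  proof (rule cinner_eqI)
    fix z
    have "sym_op (op_powr A s)" using pos_op_op_powr[OF A s] by (simp add: pos_op_def)
    then show "cinner z (U (U (op_powr A s x))) = cinner z (op_powr A s x)"
      by (simp add: Us[symmetric] sym_opD(2)[symmetric] AsUU[OF s])
  qed
  have AUU: "A (U (U x)) = A x" for x
    using AsUU[of 1 x] by (simp add: op_powr_one[OF A])
  have T_eq: "T x = U (A x)" for x using TU by (simp add: A_def)
  have adjT: "cadjoint T = (\<lambda>x. A (U x))"
    by (rule cadjoint_eqI) (simp add: T_eq Us As)
  have adjadjT: "cadjoint (cadjoint T) = T"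
    by (rule cadjoint_eqI) (simp add: adjT T_eq Us As)
  define Q where "Q = cadjoint T \<circ> T"
  have Q: "pos_op Q" unfolding Q_def by (rule pos_op_cadjoint_comp[OF T])
  have Qx: "Q x = A (A x)" for x
    using op_abs_op_abs[OF T, of x] by (simp add: Q_def A_def)
  have A_eq: "A = op_powr Q (1/2)" by (simp add: A_def op_abs_def Q_def)
  have "cadjoint (cadjoint T) \<circ> cadjoint T = (\<lambda>x. U (Q (U x)))"
    unfolding adjadjT by (simp add: adjT T_eq Qx fun_eq_iff)
  then have "op_abs (cadjoint T) x = op_powr (\<lambda>x. U (Q (U x))) (1/2) x" for x
    by (simp add: op_abs_def)
  also have "op_powr (\<lambda>x. U (Q (U x))) (1/2) x = U (A (U x))" for x
    unfolding A_eq by (rule op_powr_conj[OF Q U]) (simp_all add: Qx AUU)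
  finally have absT': "op_abs (cadjoint T) = (\<lambda>x. U (A (U x)))" by auto
  define B where "B x = U (op_powr A r (U x))" for x
  have B: "op_powr (op_abs (cadjoint T)) r x = B x" for x
    unfolding absT' B_def by (rule op_powr_conj[OF A U AUU pr(2)])
  have pA: "pos_op (op_powr A s)" if "s > 0" for s by (rule pos_op_op_powr[OF A that])
  have bB: "bounded_clinear B"
    unfolding B_def
    using pA[OF pr(2)] by (intro bounded_clinear_compose[OF bU bounded_clinear_compose[OF _ bU]])
      (simp add: pos_op_def sym_op_def)
  define m where "m = p + r"
  have m: "m > 0" "p < m" "m - p = r" using pr by (simp_all add: m_def)
  let ?C = "op_powr A m"
  have Uiso: "norm (U (op_powr A s x)) = norm (op_powr A s x)" if "s > 0" for s x
    by (simp add: norm_eq_sqrt_cinner Us UUAs[OF that])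
  have par: "(norm (?C y))\<^sup>2 \<le> norm (?C (U (?C y))) * norm y" for y
  proof (cases "?C y = 0")
    case False
    define x where "x = U (op_powr A p y)"
    have Bx: "B x = U (?C y)"
      using op_powr_add[OF A pr(2) pr(1), of y] pr by (simp add: B_def x_def UUAs m_def add.commute)
    have nBx: "norm (B x) = norm (?C y)" by (simp add: Bx Uiso m)
    then have Bx0: "B x \<noteq> 0" using False by auto
    have nx: "norm x = norm (op_powr A p y)" by (simp add: x_def Uiso pr)
    note pl = absolute_paranormal_ln[OF T pn pr B bB Bx0, folded A_def]
    have Ay: "op_powr A p y \<noteq> 0"
      using False ker[OF m(1), of y] ker[OF pr(1), of y] by simp
    have y0: "y \<noteq> 0" using Ay pA[OF pr(1)] by (auto simp: pos_op_def sym_op_def bounded_clinearD)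
    note c1 = op_powr_ln_convex[OF A pr(1) m(2) pl(1)]
    note c2 = op_powr_ln_convex(2)[OF A pr(1) m(2) Ay]
    define a b c e f where "a = ln (norm (?C (U (?C y))))" and "b = ln (norm (?C y))" and "c = ln (norm y)"
      and "e = ln (norm (op_powr A p (B x)))" and "f = ln (norm (op_powr A p y))"
    have 1: "m * b \<le> r * e + p * f"
      using pl(2) by (simp add: nBx nx a_def b_def c_def e_def f_def m_def)
    have 2: "m * e \<le> p * a + r * b"
      using c1(2) unfolding nBx m(3) by (simp add: Bx a_def b_def e_def)
    have 3: "m * f \<le> p * b + r * c"
      using c2 by (simp add: m(3) b_def c_def f_def)
    have "m * (m * b) \<le> m * (r * e + p * f)" using 1 m by (intro mult_left_mono) auto
    also have "\<dots> = r * (m * e) + p * (m * f)" by (simp add: algebra_simps)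
    also have "\<dots> \<le> r * (p * a + r * b) + p * (p * b + r * c)"
      using 2 3 pr by (intro add_mono mult_left_mono) auto
    finally have "(p * r) * (2 * b) \<le> (p * r) * (a + c)"
      by (simp add: m_def algebra_simps)
    then have "2 * b \<le> a + c" using pr by (simp add: mult_le_cancel_left)
    then have "ln ((norm (?C y))\<^sup>2) \<le> ln (norm (?C (U (?C y))) * norm y)"
      using c1(1) False y0 by (simp add: Bx ln_mult ln_realpow a_def b_def c_def)
    then show ?thesis
      using c1(1) False y0 by (simp add: Bx)
  qed simp
  have "U (?C x) = ?C (U x)" for x
  proof (rule commute_if_paranormal_symmetry[OF pA[of "m / 2"] _ U ker[OF m(1)] UUU par])
    show "?C x = op_powr A (m / 2) (op_powr A (m / 2) x)" for x
      using op_powr_add[OF A, of "m / 2" "m / 2" x] m by simp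
  qed (use m in simp)
  then have "U (A x) = A (U x)" for x
    by (rule commute_with_root[OF A m(1) bU])
  then show ?thesis
    by (simp add: self_adjoint_def adjT T_eq fun_eq_iff)
qed

theorem theorem3p2:
  fixes T U :: "'a::chilbert_space \<Rightarrow> 'a" and p r :: real
  assumes "bounded_clinear T"
    and "polar_decomposition T U"
    and "p > 0" and "r > 0"
  shows "self_adjoint T \<longleftrightarrow> absolute_paranormal p r T \<and> self_adjoint U"
  using assms self_adjoint_imp_polar_factor_self_adjoint self_adjoint_imp_absolute_paranormal
    absolute_paranormal_imp_self_adjoint by blast

end
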